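(* Let $G$ be a projective algebraic group over $\mathbb{C}$ and let $\Gamma$ be a smooth projective curve over $\mathbb{C}$. Let $\Gamma(e)$ be the $\Gamma$-equivalence class of the identity $e$ of $G$, and let $\theta: G\to G/\Gamma(e)$, $g\mapsto[g]$, be the natural quotient homomorphism (on $\mathbb{C}$-points). Then $\theta^{-1}([e])$ is a finite union of translates of an abelian subvariety $A_0$ of $G$; that is, there exist an abelian subvariety $A_0\subset G$ and finitely many points $x_1,\dots,x_n\in G$ such that $\theta^{-1}([e])=\bigcup_{i=1}^n (x_i+A_0)$. Hence $\theta^{-1}([e])$ is an algebraic subgroup of $G$.
   Context: The group law of $G$ is written additively and $e$ denotes the identity element. Points, subsets and unions are at the level of $\mathbb{C}$-points. A smooth projective curve is assumed irreducible. $\Gamma$-equivalence: two $\mathbb{C}$-points $a,b$ of $G$ are $\Gamma$-equivalent if they are connected by a finite chain of rational maps from $\Gamma$, i.e. there are points $a=g_0,g_1,\dots,g_n=b$ of $G$ such that for each $1\le j\le n$ there are a rational map $f_j:\Gamma\to G$ (which is automatically a morphism, since $\Gamma$ is a smooth curve and $G$ is projective) and two points $0_j,\infty_j$ of $\Gamma$ with $f_j(0_j)=g_{j-1}$ and $f_j(\infty_j)=g_j$. The set $\Gamma(e)$ of points $\Gamma$-equivalent to $e$ is a subgroup of $G$, and $G/\Gamma(e)$ (also denoted $G/\Gamma$) is a group. $[g]$ denotes the class of $g$ in $G/\Gamma(e)$. *)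

theory Defs
  imports "HOL-Analysis.Analysis" "HOL-Algebra.Coset"
begin

section \<open>Projective space and its Zariski topology\<close>

text \<open>
  The type \<open>'n cproj\<close> is the set of complex points of the projective space of dimension
  \<open>CARD('n) - 1\<close>, a point being a line through the origin. All varieties below are reduced and
  are given by their complex points; over the complex numbers a group scheme of finite type is
  automatically reduced, so nothing is lost for algebraic groups.
\<close>

typedef ('n::finite) cproj = "{L :: (complex^'n) set. vec.subspace L \<and> vec.dim L = 1}"
  morphisms line_of Proj
proof
  have "(1 :: complex^'n) \<noteq> 0" by simp
  then have "vec.dim (vec.span {1 :: complex^'n}) = 1"
    by simp
  then show "vec.span {1 :: complex^'n} \<in> {L. vec.subspace L \<and> vec.dim L = 1}"
    by (simp add: vec.subspace_span)
qed

definition homog_coords :: "('n::finite) cproj \<Rightarrow> (complex^'n) set" where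
  "homog_coords p = line_of p - {0}"

text \<open>
  Homogeneous polynomials of degree \<open>d\<close>, as functions; since the field is infinite, these
  correspond bijectively to the formal ones.
\<close>

definition form :: "nat \<Rightarrow> (complex^('n::finite) \<Rightarrow> complex) \<Rightarrow> bool" where
  "form d F \<longleftrightarrow> (\<exists>c :: ('n \<Rightarrow> nat) \<Rightarrow> complex.
     F = (\<lambda>x. \<Sum>\<alpha> | (\<Sum>i\<in>UNIV. \<alpha> i) = d. c \<alpha> * (\<Prod>i\<in>UNIV. x $ i ^ \<alpha> i)))"

lemma finite_exponents: "finite {\<alpha> :: ('n::finite) \<Rightarrow> nat. (\<Sum>i\<in>UNIV. \<alpha> i) = d}"
proof (rule finite_subset)
  show "{\<alpha> :: 'n \<Rightarrow> nat. (\<Sum>i\<in>UNIV. \<alpha> i) = d} \<subseteq> PiE UNIV (\<lambda>_. {..d})"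
    by (auto intro!: member_le_sum)
qed (simp add: finite_PiE)

definition vanishes_at :: "(complex^('n::finite) \<Rightarrow> complex) \<Rightarrow> 'n cproj \<Rightarrow> bool" where
  "vanishes_at F p \<longleftrightarrow> (\<forall>v\<in>homog_coords p. F v = 0)"

definition zariski_closed :: "('n::finite) cproj set \<Rightarrow> bool" where
  "zariski_closed S \<longleftrightarrow>
     (\<exists>\<F>. (\<forall>F\<in>\<F>. \<exists>d. form d F) \<and> S = {p. \<forall>F\<in>\<F>. vanishes_at F p})"

definition zariski_irreducible :: "('n::finite) cproj set \<Rightarrow> bool" where
  "zariski_irreducible S \<longleftrightarrow> S \<noteq> {} \<and>
     (\<forall>A B. zariski_closed A \<and> zariski_closed B \<and> S \<subseteq> A \<union> B \<longrightarrow> S \<subseteq> A \<or> S \<subseteq> B)"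

text \<open>Krull dimension of a closed set (with value \<open>0\<close> on the empty set).\<close>

definition zariski_dim :: "('n::finite) cproj set \<Rightarrow> enat" where
  "zariski_dim X = Sup {enat k | k. \<exists>Z :: nat \<Rightarrow> 'n cproj set.
     (\<forall>i\<le>k. zariski_closed (Z i) \<and> zariski_irreducible (Z i) \<and> Z i \<subseteq> X) \<and>
     (\<forall>i<k. Z i \<subset> Z (Suc i))}"

section \<open>Smooth projective curves\<close>

text \<open>
  The Zariski tangent space at \<open>v\<close> of the affine cone over \<open>X\<close>: the common kernel of the
  differentials at \<open>v\<close> of all forms in the homogeneous ideal of \<open>X\<close>. Nonsingularity is the
  Jacobian criterion; the tangent space of the cone has one dimension more than that of \<open>X\<close>.
\<close>

definition cone_tangent_space ::
  "('n::finite) cproj set \<Rightarrow> complex^'n \<Rightarrow> (complex^'n) set" where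
  "cone_tangent_space X v =
     {w. \<forall>d F. form d F \<and> (\<forall>q\<in>X. vanishes_at F q) \<longrightarrow>
           ((\<lambda>t. F (v + t *s w)) has_field_derivative 0) (at 0)}"

definition nonsingular_at :: "('n::finite) cproj set \<Rightarrow> 'n cproj \<Rightarrow> bool" where
  "nonsingular_at X p \<longleftrightarrow>
     (\<forall>v\<in>homog_coords p. enat (vec.dim (cone_tangent_space X v)) = zariski_dim X + 1)"

definition smooth_projective_curve :: "('n::finite) cproj set \<Rightarrow> bool" where
  "smooth_projective_curve X \<longleftrightarrow>
     zariski_closed X \<and> zariski_irreducible X \<and> zariski_dim X = 1 \<and> (\<forall>p\<in>X. nonsingular_at X p)"

section \<open>Morphisms and products\<close>

text \<open>
  Morphisms are the maps given, in a neighbourhood (the complement of \<open>C\<close>) of each point, by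
  forms of equal degree without common zero there (\<open>homog_coords\<close> excludes the zero vector).
\<close>

definition morphism_on ::
  "('n::finite) cproj set \<Rightarrow> ('m::finite) cproj set \<Rightarrow> ('n cproj \<Rightarrow> 'm cproj) \<Rightarrow> bool" where
  "morphism_on X Y f \<longleftrightarrow> f ` X \<subseteq> Y \<and>
     (\<forall>p\<in>X. \<exists>C d F. zariski_closed C \<and> p \<notin> C \<and> (\<forall>j::'m. form d (F j)) \<and>
        (\<forall>q\<in>X - C. \<forall>v\<in>homog_coords q. (\<chi> j. F j v) \<in> homog_coords (f q)))"

definition tensor :: "complex^('n::finite) \<Rightarrow> complex^('m::finite) \<Rightarrow> complex^('n \<times> 'm)" where
  "tensor v w = (\<chi> k. v $ fst k * w $ snd k)"

text \<open>The Segre embedding; the product variety of \<open>X\<close> and \<open>Y\<close> is \<open>segre ` (X \<times> Y)\<close>.\<close>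

definition segre :: "('n::finite) cproj \<times> ('m::finite) cproj \<Rightarrow> ('n \<times> 'm) cproj" where
  "segre = (\<lambda>(p, q). Proj (vec.span {tensor v w | v w. v \<in> line_of p \<and> w \<in> line_of q}))"

lemma line_of_eq_span:
  fixes p :: "('n::finite) cproj"
  assumes "v \<in> homog_coords p"
  shows "line_of p = vec.span {v}"
proof -
  have L: "vec.subspace (line_of p)" "vec.dim (line_of p) = 1" using line_of[of p] by auto
  have v: "v \<in> line_of p" "v \<noteq> 0" using assms by (auto simp: homog_coords_def)
  have "line_of p \<subseteq> vec.span {v}"
    by (simp add: L v vec.card_ge_dim_independent)
  moreover have "vec.span {v} \<subseteq> line_of p" using L v by (intro vec.span_minimal) auto
  ultimately show ?thesis by blast
qed

lemma tensor_in_segre: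
  assumes v: "v \<in> homog_coords p" and w: "w \<in> homog_coords q"
  shows "tensor v w \<in> homog_coords (segre (p, q))"
proof -
  have nz: "tensor v w \<noteq> 0"
  proof -
    obtain i j where "v $ i \<noteq> 0" "w $ j \<noteq> 0"
      using v w by (auto simp: homog_coords_def vec_eq_iff)
    then have "tensor v w $ (i, j) \<noteq> 0" by (simp add: tensor_def)
    then show ?thesis by (metis zero_index)
  qed
  let ?S = "{tensor v w | v w. v \<in> line_of p \<and> w \<in> line_of q}"
  have "?S \<subseteq> vec.span {tensor v w}"
  proof clarify
    fix v' w' assume "v' \<in> line_of p" "w' \<in> line_of q"
    then obtain a b where "v' = a *s v" "w' = b *s w"
      by (auto simp: line_of_eq_span[OF v] line_of_eq_span[OF w] vec.span_singleton)
    then have "tensor v' w' = (a * b) *s tensor v w"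
      by (simp add: tensor_def vec_eq_iff)
    then show "tensor v' w' \<in> vec.span {tensor v w}"
      by (auto simp: vec.span_singleton)
  qed
  moreover have "tensor v w \<in> ?S" using v w by (auto simp: homog_coords_def)
  ultimately have S: "vec.span ?S = vec.span {tensor v w}"
    by (simp add: vec.span_eq vec.span_base del: mem_Collect_eq)
  have "vec.dim (vec.span {tensor v w}) = 1"
    using nz by simp
  then have "line_of (segre (p, q)) = vec.span {tensor v w}"
    by (simp add: segre_def S Proj_inverse vec.subspace_span)
  then show ?thesis using nz by (simp add: homog_coords_def vec.span_base)
qed

definition morphism2_on :: "('n::finite) cproj set \<Rightarrow> ('m::finite) cproj set \<Rightarrow>
    ('k::finite) cproj set \<Rightarrow> ('n cproj \<Rightarrow> 'm cproj \<Rightarrow> 'k cproj) \<Rightarrow> bool" where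
  "morphism2_on X Y Z f \<longleftrightarrow>
     (\<exists>\<mu>. morphism_on (segre ` (X \<times> Y)) Z \<mu> \<and> (\<forall>p\<in>X. \<forall>q\<in>Y. \<mu> (segre (p, q)) = f p q))"

section \<open>Projective algebraic groups\<close>

text \<open>
  Connectedness, and hence commutativity, is not part of the definition; group operations are
  therefore written with the multiplicative notation of the group library.
\<close>

definition projective_algebraic_group :: "('n::finite) cproj monoid \<Rightarrow> bool" where
  "projective_algebraic_group G \<longleftrightarrow> group G \<and> zariski_closed (carrier G) \<and>
     morphism2_on (carrier G) (carrier G) (carrier G) (\<lambda>x y. x \<otimes>\<^bsub>G\<^esub> y) \<and>
     morphism_on (carrier G) (carrier G) (\<lambda>x. inv\<^bsub>G\<^esub> x)"

definition abelian_variety :: "('n::finite) cproj monoid \<Rightarrow> bool" where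
  "abelian_variety A \<longleftrightarrow> projective_algebraic_group A \<and> zariski_irreducible (carrier A)"

definition algebraic_subgroup :: "('n::finite) cproj set \<Rightarrow> 'n cproj monoid \<Rightarrow> bool" where
  "algebraic_subgroup H G \<longleftrightarrow> subgroup H G \<and> zariski_closed H"

definition abelian_subvariety :: "('n::finite) cproj set \<Rightarrow> 'n cproj monoid \<Rightarrow> bool" where
  "abelian_subvariety A G \<longleftrightarrow> algebraic_subgroup A G \<and> abelian_variety (G\<lparr>carrier := A\<rparr>)"

section \<open>Equivalence along a curve\<close>

text \<open>
  A rational map from a smooth curve to a projective variety is a morphism defined everywhere,
  so the links of a chain are morphisms.
\<close>

definition curve_equiv :: "('m::finite) cproj set \<Rightarrow> ('n::finite) cproj monoid \<Rightarrow>
    'n cproj \<Rightarrow> 'n cproj \<Rightarrow> bool" where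
  "curve_equiv \<Gamma> G a b \<longleftrightarrow> (\<exists>(n :: nat) g. g 0 = a \<and> g n = b \<and> (\<forall>j\<le>n. g j \<in> carrier G) \<and>
     (\<forall>j\<in>{1..n}. \<exists>f s t. morphism_on \<Gamma> (carrier G) f \<and> s \<in> \<Gamma> \<and> t \<in> \<Gamma> \<and>
        f s = g (j - 1) \<and> f t = g j))"

definition curve_class ::
  "('m::finite) cproj set \<Rightarrow> ('n::finite) cproj monoid \<Rightarrow> 'n cproj set" where
  "curve_class \<Gamma> G = {g. curve_equiv \<Gamma> G \<one>\<^bsub>G\<^esub> g}"

text \<open>The quotient map to \<open>G Mod curve_class \<Gamma> G\<close>, whose elements are cosets.\<close>

definition curve_quotient_map :: "('m::finite) cproj set \<Rightarrow> ('n::finite) cproj monoid \<Rightarrow>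
    'n cproj \<Rightarrow> 'n cproj set" where
  "curve_quotient_map \<Gamma> G g = curve_class \<Gamma> G #>\<^bsub>G\<^esub> g"

end

theory Submission
  imports Defs "HOL-Computational_Algebra.Fundamental_Theorem_Algebra"
begin

text \<open>
  The kernel of the quotient map is the equivalence class \<open>H\<close> of the identity, and \<open>H\<close> itself is
  an abelian subvariety; a single translate suffices.

  Left translation preserves equivalence, so \<open>H\<close> is a subgroup, and it is the union of all
  products \<open>f\<^sub>1(\<Gamma>) \<dots> f\<^sub>k(\<Gamma>)\<close> of images of the curve under morphisms that hit the identity
  (\<open>curve_class_eq_Union_products\<close>). Each such product is closed, because images of projective
  varieties are closed, and irreducible, because translations are homeomorphisms of the Zariski
  topology. Each contains the identity, so a product of two of them contains both. Strictly
  ascending chains of irreducible closed sets have bounded length, so there is a maximal product;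
  it contains all the others and therefore equals \<open>H\<close> (\<open>curve_class_closed_irreducible\<close>).

  Two facts of algebraic geometry carry this argument. The first is the closedness of images
  (\<open>zariski_closed_image\<close>). The graph of a morphism is given by bihomogeneous forms, and its
  projection is closed by elimination theory (\<open>no_common_zero_open\<close>): by the projective
  Nullstellensatz, forms without a common zero generate all forms of some degree, and this is a
  nondegeneracy condition on a linear system, hence open in the parameters. The Nullstellensatz
  is derived from the uncountability of the complex numbers and the fundamental theorem of
  algebra. The second is the bound on chains (\<open>no_infinite_chain_of_irreducibles\<close>), obtained by
  counting linearly independent forms.
\<close>

section \<open>Forms\<close>

definition exponents :: "nat \<Rightarrow> ('n::finite \<Rightarrow> nat) set" where
  "exponents d = {\<alpha>. (\<Sum>i\<in>UNIV. \<alpha> i) = d}"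

definition power_product :: "('n::finite \<Rightarrow> nat) \<Rightarrow> complex^'n \<Rightarrow> complex" where
  "power_product \<alpha> x = (\<Prod>i\<in>UNIV. x $ i ^ \<alpha> i)"

definition form_of :: "nat \<Rightarrow> (('n::finite \<Rightarrow> nat) \<Rightarrow> complex) \<Rightarrow> complex^'n \<Rightarrow> complex" where
  "form_of d c = (\<lambda>x. \<Sum>\<alpha>\<in>exponents d. c \<alpha> * power_product \<alpha> x)"

lemma form_iff: "form d F \<longleftrightarrow> (\<exists>c. F = form_of d c)"
  by (simp add: form_def form_of_def exponents_def power_product_def)

lemma form_of_form [simp]: "form d (form_of d c)"
  by (auto simp: form_iff)

lemma finite_exponents' [simp]: "finite (exponents d)"
  by (simp add: exponents_def finite_exponents)

lemma power_product_add:
  "power_product (\<lambda>i. \<alpha> i + \<beta> i) x = power_product \<alpha> x * power_product \<beta> x"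
  by (simp add: power_product_def power_add prod.distrib)

lemma exponents_add:
  "\<alpha> \<in> exponents d \<Longrightarrow> \<beta> \<in> exponents e \<Longrightarrow> (\<lambda>i. \<alpha> i + \<beta> i) \<in> exponents (d + e)"
  by (simp add: exponents_def sum.distrib)

lemma form_zero: "form d (\<lambda>_. 0)"
  unfolding form_iff by (rule exI[of _ "\<lambda>_. 0"]) (simp add: form_of_def)

lemma form_add: "form d F \<Longrightarrow> form d G \<Longrightarrow> form d (\<lambda>x. F x + G x)"
  unfolding form_iff
proof (elim exE)
  fix b c assume "F = form_of d b" "G = form_of d c"
  then show "\<exists>c. (\<lambda>x. F x + G x) = form_of d c"
    by (intro exI[of _ "\<lambda>\<alpha>. b \<alpha> + c \<alpha>"]) (simp add: form_of_def sum.distrib algebra_simps)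
qed

lemma form_cmult: "form d F \<Longrightarrow> form d (\<lambda>x. a * F x)"
  unfolding form_iff
proof (elim exE)
  fix b assume "F = form_of d b"
  then show "\<exists>c. (\<lambda>x. a * F x) = form_of d c"
    by (intro exI[of _ "\<lambda>\<alpha>. a * b \<alpha>"]) (simp add: form_of_def sum_distrib_left algebra_simps)
qed

lemma form_diff: "form d F \<Longrightarrow> form d G \<Longrightarrow> form d (\<lambda>x. F x - G x)"
  using form_add[of d F "\<lambda>x. (-1) * G x"] form_cmult[of d G "-1"] by simp

lemma form_sum: "(\<And>a. a \<in> A \<Longrightarrow> form d (F a)) \<Longrightarrow> form d (\<lambda>x. \<Sum>a\<in>A. F a x)"
  by (induction A rule: infinite_finite_induct) (auto intro: form_zero form_add)

lemma form_power_product: "\<alpha> \<in> exponents d \<Longrightarrow> form d (power_product \<alpha>)"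
  unfolding form_iff
  by (rule exI[of _ "\<lambda>\<beta>. of_bool (\<beta> = \<alpha>)"]) (simp add: form_of_def if_distrib of_bool_def
    if_distribR sum.delta[OF finite_exponents'] cong: if_cong)

lemma form_mult:
  assumes "form d F" "form e G" shows "form (d + e) (\<lambda>x. F x * G x)"
proof -
  obtain b c where *: "F = form_of d b" "G = form_of e c" using assms by (auto simp: form_iff)
  have "(\<lambda>x. F x * G x) = (\<lambda>x. \<Sum>\<alpha>\<in>exponents d. \<Sum>\<beta>\<in>exponents e.
      (b \<alpha> * c \<beta>) * power_product (\<lambda>i. \<alpha> i + \<beta> i) x)"
    by (simp add: * form_of_def sum_product power_product_add algebra_simps)
  then show ?thesis
    by (auto intro!: form_sum form_cmult form_power_product exponents_add)
qed

lemma form_const: "form 0 (\<lambda>_ :: complex^('n::finite). a)"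
proof -
  have "form 0 (power_product (\<lambda>_ :: 'n. 0))"
    by (rule form_power_product) (simp add: exponents_def)
  from form_cmult[OF this, of a] show ?thesis by (simp add: power_product_def)
qed

lemma form_coordinate: "form 1 (\<lambda>x. x $ i)"
proof -
  have "form 1 (power_product (\<lambda>j. if j = i then 1 else 0))"
    by (rule form_power_product) (simp add: exponents_def)
  moreover have "power_product (\<lambda>j. if j = i then 1 else 0) = (\<lambda>x. x $ i)"
    by (simp add: power_product_def fun_eq_iff if_distrib cong: if_cong)
  ultimately show ?thesis by simp
qed

lemma form_power: "form d F \<Longrightarrow> form (d * m) (\<lambda>x. F x ^ m)"
proof (induction m)
  case (Suc m)
  from form_mult[OF Suc.prems Suc.IH[OF Suc.prems]] show ?case by (simp add: algebra_simps)
qed (simp add: form_const)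

lemma form_prod:
  assumes "finite A" "\<And>a. a \<in> A \<Longrightarrow> form (d a) (F a)"
  shows "form (sum d A) (\<lambda>x. \<Prod>a\<in>A. F a x)"
  using assms
proof (induction A rule: finite_induct)
  case (insert a A)
  have "form (d a) (F a)" "form (sum d A) (\<lambda>x. \<Prod>a\<in>A. F a x)" using insert by auto
  from form_mult[OF this] show ?case using insert.hyps by simp
qed (simp add: form_const)

lemma form_compose:
  fixes F :: "complex^('n::finite) \<Rightarrow> complex" and G :: "'n \<Rightarrow> complex^('m::finite) \<Rightarrow> complex"
  assumes "form d F" "\<And>j. form e (G j)"
  shows "form (e * d) (\<lambda>x. F (\<chi> j. G j x))"
proof -
  obtain c where F: "F = form_of d c" using assms(1) by (auto simp: form_iff)
  have "form (e * d) (\<lambda>x. \<Prod>j\<in>UNIV. G j x ^ \<alpha> j)" if "\<alpha> \<in> exponents d" for \<alpha>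
  proof -
    have "form (\<Sum>j\<in>UNIV. e * \<alpha> j) (\<lambda>x. \<Prod>j\<in>UNIV. G j x ^ \<alpha> j)"
      by (intro form_prod form_power assms) simp
    then show ?thesis using that by (simp add: exponents_def flip: sum_distrib_left)
  qed
  then show ?thesis
    by (auto simp: F form_of_def power_product_def intro!: form_sum form_cmult)
qed

lemma power_product_scale:
  "\<alpha> \<in> exponents d \<Longrightarrow> power_product \<alpha> (a *s x) = a ^ d * power_product \<alpha> x"
  by (auto simp: power_product_def exponents_def power_mult_distrib prod.distrib power_sum)

lemma form_homogeneous: "form d F \<Longrightarrow> F (a *s x) = a ^ d * F x"
  by (auto simp: form_iff form_of_def power_product_scale sum_distrib_left mult.left_commute)

text \<open>
  Power products are pairwise distinct multiplicative functions, so Dedekind's argument for the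
  independence of characters applies: rescaling by \<open>2\<close> a coordinate in which two exponent
  vectors differ multiplies their power products by distinct factors, and subtracting a multiple
  of the original relation eliminates one of the terms.
\<close>

lemma power_products_independent:
  assumes "finite A" "\<And>x :: complex^('n::finite). (\<Sum>\<alpha>\<in>A. c \<alpha> * power_product \<alpha> x) = 0"
  shows "\<forall>\<alpha>\<in>A. c \<alpha> = 0"
  using assms
proof (induction A arbitrary: c rule: finite_induct)
  case (insert \<beta> A)
  have A0: "c \<alpha> = 0" if "\<alpha> \<in> A" for \<alpha>
  proof -
    obtain i where i: "\<alpha> i \<noteq> \<beta> i" using insert \<open>\<alpha> \<in> A\<close> by (metis ext)
    define \<tau> :: "complex^'n \<Rightarrow> complex^'n" where "\<tau> x = (\<chi> j. if j = i then 2 * x $ j else x $ j)" for x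
    have \<tau>: "power_product \<gamma> (\<tau> x) = 2 ^ \<gamma> i * power_product \<gamma> x" for \<gamma> x
    proof -
      have "power_product \<gamma> (\<tau> x) = (\<Prod>j\<in>UNIV. (if j = i then 2 ^ \<gamma> i else 1) * x $ j ^ \<gamma> j)"
        unfolding power_product_def \<tau>_def by (intro prod.cong) (auto simp: power_mult_distrib)
      then show ?thesis by (simp add: prod.distrib power_product_def)
    qed
    have "(\<Sum>\<gamma>\<in>A. (c \<gamma> * (2 ^ \<gamma> i - 2 ^ \<beta> i)) * power_product \<gamma> x) = 0" for x
    proof -
      have "(\<Sum>\<gamma>\<in>insert \<beta> A. c \<gamma> * power_product \<gamma> (\<tau> x))
          - 2 ^ \<beta> i * (\<Sum>\<gamma>\<in>insert \<beta> A. c \<gamma> * power_product \<gamma> x) = 0"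
        by (simp only: insert.prems) simp
      then have "(\<Sum>\<gamma>\<in>insert \<beta> A. (c \<gamma> * (2 ^ \<gamma> i - 2 ^ \<beta> i)) * power_product \<gamma> x) = 0"
        by (simp only: \<tau> sum_distrib_left flip: sum_subtractf) (simp add: algebra_simps)
      then show ?thesis using insert.hyps by simp
    qed
    then have "c \<alpha> * (2 ^ \<alpha> i - 2 ^ \<beta> i) = 0"
      using insert.IH[of "\<lambda>\<gamma>. c \<gamma> * (2 ^ \<gamma> i - 2 ^ \<beta> i)"] that by blast
    moreover have "(2::complex) ^ \<alpha> i \<noteq> 2 ^ \<beta> i"
    proof
      assume "(2::complex) ^ \<alpha> i = 2 ^ \<beta> i"
      then have "norm ((2::complex) ^ \<alpha> i) = norm ((2::complex) ^ \<beta> i)" by simp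
      then have "(2::real) ^ \<alpha> i = 2 ^ \<beta> i" by (simp add: norm_power)
      then show False using i by simp
    qed
    ultimately show ?thesis by simp
  qed
  have "c \<beta> * power_product \<beta> (\<chi> _. 1) = 0"
    using insert.prems[of "\<chi> _. 1"] insert.hyps A0 by simp
  then have "c \<beta> = 0" by (simp add: power_product_def)
  with A0 show ?case by simp
qed simp

section \<open>Linear algebra over finite index sets\<close>

lemma dependent_if_card_less:
  fixes M :: "'k \<Rightarrow> 'i \<Rightarrow> complex"
  assumes "finite I" "finite K" "card I < card K"
  shows "\<exists>a. (\<exists>k\<in>K. a k \<noteq> 0) \<and> (\<forall>i\<in>I. (\<Sum>k\<in>K. a k * M k i) = 0)"
  using assms
proof (induction I arbitrary: K M rule: finite_induct)
  case empty
  then show ?case by (intro exI[of _ "\<lambda>_. 1"]) (auto simp: card_gt_0_iff)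
next
  case (insert j I)
  show ?case
  proof (cases "\<forall>k\<in>K. M k j = 0")
    case True
    have "card I < card K" using insert by simp
    from insert.IH[OF \<open>finite K\<close> this, of M] obtain a where
      "\<exists>k\<in>K. a k \<noteq> 0" "\<forall>i\<in>I. (\<Sum>k\<in>K. a k * M k i) = 0" by blast
    then show ?thesis using True by (intro exI[of _ a]) simp
  next
    case False
    then obtain l where l: "l \<in> K" "M l j \<noteq> 0" by blast
    define N where "N k i = M k i - M k j / M l j * M l i" for k i
    have "card I < card (K - {l})" using insert l by simp
    from insert.IH[OF _ this, of N] insert.prems(1) obtain a where
      a: "\<exists>k\<in>K - {l}. a k \<noteq> 0" "\<forall>i\<in>I. (\<Sum>k\<in>K - {l}. a k * N k i) = 0" by auto
    define s where "s = - (\<Sum>k\<in>K - {l}. a k * M k j) / M l j"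
    define b where "b = a(l := s)"
    have split: "(\<Sum>k\<in>K. b k * M k i) = (\<Sum>k\<in>K - {l}. a k * M k i) + s * M l i" for i
      by (subst sum.remove[OF insert.prems(1) l(1)]) (simp add: b_def)
    have "(\<Sum>k\<in>K - {l}. a k * N k i) = (\<Sum>k\<in>K. b k * M k i)" for i
    proof -
      have "(\<Sum>k\<in>K - {l}. a k * N k i)
          = (\<Sum>k\<in>K - {l}. a k * M k i - (a k * M k j) * (M l i / M l j))"
        by (simp add: N_def right_diff_distrib mult.assoc)
      also have "\<dots> = (\<Sum>k\<in>K - {l}. a k * M k i) - (\<Sum>k\<in>K - {l}. a k * M k j) * (M l i / M l j)"
        by (simp only: sum_subtractf sum_distrib_right)
      finally show ?thesis by (simp add: split s_def)
    qed
    then have "\<forall>i\<in>I. (\<Sum>k\<in>K. b k * M k i) = 0" using a by metis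
    moreover have "(\<Sum>k\<in>K. b k * M k j) = 0" unfolding split s_def using l by simp
    moreover have "\<exists>k\<in>K. b k \<noteq> 0" using a(1) by (auto simp: b_def)
    ultimately show ?thesis by blast
  qed
qed

text \<open>
  Gaussian elimination on a homogeneous linear system whose coefficients are forms in a
  parameter \<open>y\<close>. All entries of one equation have the same degree, so the entries
  \<open>r\<^sub>0 k * r i - r k * r\<^sub>0 i\<close> after an elimination step are again forms of a common degree, and
  the product of the pivots is the required form.
\<close>

lemma only_trivial_solution_open:
  fixes R :: "('i \<Rightarrow> complex^('n::finite) \<Rightarrow> complex) set"
  assumes "finite I" "\<forall>r\<in>R. \<exists>e. \<forall>i. form e (r i)"
    and "\<forall>v. (\<forall>r\<in>R. (\<Sum>i\<in>I. r i y\<^sub>0 * v i) = 0) \<longrightarrow> (\<forall>i\<in>I. v i = 0)"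
  shows "\<exists>e P. form e P \<and> P y\<^sub>0 \<noteq> 0 \<and>
    (\<forall>y. P y \<noteq> 0 \<longrightarrow> (\<forall>v. (\<forall>r\<in>R. (\<Sum>i\<in>I. r i y * v i) = 0) \<longrightarrow> (\<forall>i\<in>I. v i = 0)))"
  using assms
proof (induction I arbitrary: R rule: finite_induct)
  case empty
  then show ?case by (intro exI[of _ 0] exI[of _ "\<lambda>_. 1"]) (simp add: form_const)
next
  case (insert k I)
  have "\<exists>r\<in>R. r k y\<^sub>0 \<noteq> 0"
  proof (rule ccontr)
    assume *: "\<not> ?thesis"
    have "(\<Sum>i\<in>insert k I. r i y\<^sub>0 * (if i = k then 1 else 0)) = 0" if "r \<in> R" for r
      using * that insert by (simp add: if_distrib sum.delta cong: if_cong)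
    with insert.prems(2)[rule_format, of "\<lambda>i. if i = k then 1 else 0" k] show False by simp
  qed
  then obtain p where p: "p \<in> R" "p k y\<^sub>0 \<noteq> 0" by blast
  define step where "step r = (\<lambda>i y. p k y * r i y - r k y * p i y)" for r
  have eq: "(\<Sum>i\<in>I. step r i y * v i)
      = p k y * (\<Sum>i\<in>insert k I. r i y * v i) - r k y * (\<Sum>i\<in>insert k I. p i y * v i)" for r y v
    using insert.hyps by (simp add: step_def sum_subtractf sum_distrib_left algebra_simps)
  have forms: "\<forall>r\<in>step ` R. \<exists>e. \<forall>i. form e (r i)"
  proof
    fix r assume "r \<in> step ` R"
    obtain r' d e where "r' \<in> R" "r = step r'" "\<forall>i. form d (r' i)" "\<forall>i. form e (p i)"
      using insert.prems(1) p \<open>r \<in> step ` R\<close> by blast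
    have "form (e + d) (r i)" for i
    proof -
      have "form (e + d) (\<lambda>y. p k y * r' i y)" "form (e + d) (\<lambda>y. r' k y * p i y)"
        using \<open>\<forall>i. form d (r' i)\<close> \<open>\<forall>i. form e (p i)\<close> form_mult[of e "p k" d "r' i"]
          form_mult[of d "r' k" e "p i"] by (auto simp: add.commute)
      then show ?thesis unfolding \<open>r = step r'\<close> step_def by (rule form_diff)
    qed
    then show "\<exists>e. \<forall>i. form e (r i)" by blast
  qed
  have "\<forall>v. (\<forall>r\<in>step ` R. (\<Sum>i\<in>I. r i y\<^sub>0 * v i) = 0) \<longrightarrow> (\<forall>i\<in>I. v i = 0)"
  proof (intro allI impI)
    fix v assume v: "\<forall>r\<in>step ` R. (\<Sum>i\<in>I. r i y\<^sub>0 * v i) = 0"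
    \<comment> \<open>Back substitution extends a solution of the reduced system to the full one.\<close>
    define s where "s = - (\<Sum>i\<in>I. p i y\<^sub>0 * v i) / p k y\<^sub>0"
    define w where "w = v(k := s)"
    have "(\<Sum>i\<in>I. f i * w i) = (\<Sum>i\<in>I. f i * v i)" for f
      using insert.hyps by (intro sum.cong) (auto simp: w_def)
    note w = this
    have p0: "(\<Sum>i\<in>insert k I. p i y\<^sub>0 * w i) = 0"
      using insert.hyps p by (simp add: w) (simp add: w_def s_def)
    have "(\<Sum>i\<in>insert k I. r i y\<^sub>0 * w i) = 0" if "r \<in> R" for r
    proof -
      have "(\<Sum>i\<in>I. step r i y\<^sub>0 * w i) = 0" using v that by (simp add: w)
      then show ?thesis using p(2) by (simp only: eq p0) simp
    qed
    then have "\<forall>i\<in>insert k I. w i = 0" using insert.prems(2) by blast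
    then show "\<forall>i\<in>I. v i = 0" using insert.hyps by (auto simp: w_def split: if_splits)
  qed
  from insert.IH[OF forms this] obtain e P where P: "form e P" "P y\<^sub>0 \<noteq> 0"
    "\<And>y v. P y \<noteq> 0 \<Longrightarrow> \<forall>r\<in>step ` R. (\<Sum>i\<in>I. r i y * v i) = 0 \<Longrightarrow> \<forall>i\<in>I. v i = 0"
    by blast
  obtain d where d: "form d (p k)" using insert.prems(1) p by blast
  have "\<forall>i\<in>insert k I. v i = 0"
    if "p k y * P y \<noteq> 0" and v: "\<forall>r\<in>R. (\<Sum>i\<in>insert k I. r i y * v i) = 0" for y v
  proof -
    have "\<forall>r\<in>step ` R. (\<Sum>i\<in>I. r i y * v i) = 0" using v p by (auto simp only: eq) simp
    then have I0: "\<forall>i\<in>I. v i = 0" using P(3)[of y v] that by simp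
    have "p k y * v k = 0" using v p insert.hyps I0 by force
    with I0 that show ?thesis by simp
  qed
  moreover have "form (d + e) (\<lambda>y. p k y * P y)" by (rule form_mult[OF d P(1)])
  ultimately show ?case using p P by (intro exI[of _ "d + e"] exI[of _ "\<lambda>y. p k y * P y"]) simp
qed

section \<open>The Nullstellensatz\<close>

text \<open>
  Polynomial functions are kept as sums of forms, because homogenization multiplies each form by
  its own power of a coordinate.
\<close>

definition polynomial_upto :: "nat \<Rightarrow> (complex^('n::finite) \<Rightarrow> complex) \<Rightarrow> bool" where
  "polynomial_upto E F \<longleftrightarrow> (\<exists>f. (\<forall>e. form e (f e)) \<and> F = (\<lambda>x. \<Sum>e\<le>E. f e x))"

definition polynomial_fun :: "(complex^('n::finite) \<Rightarrow> complex) \<Rightarrow> bool" where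
  "polynomial_fun F \<longleftrightarrow> (\<exists>E. polynomial_upto E F)"

lemma polynomial_upto_form:
  assumes "form d F" "d \<le> E" shows "polynomial_upto E F"
  unfolding polynomial_upto_def
proof (intro exI conjI)
  show "\<forall>e. form e (if e = d then F else (\<lambda>_. 0))" using assms by (simp add: form_zero)
  have "(\<Sum>e\<le>E. (if e = d then F else (\<lambda>_. 0)) x) = (\<Sum>e\<le>E. if e = d then F x else 0)" for x
    by (intro sum.cong) auto
  then show "F = (\<lambda>x. \<Sum>e\<le>E. (if e = d then F else (\<lambda>_. 0)) x)"
    using assms(2) by (simp add: fun_eq_iff)
qed

lemma polynomial_upto_add:
  assumes "polynomial_upto E F" "polynomial_upto E G"
  shows "polynomial_upto E (\<lambda>x. F x + G x)"
proof -
  obtain f g where "\<forall>e. form e (f e)" "F = (\<lambda>x. \<Sum>e\<le>E. f e x)"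
    "\<forall>e. form e (g e)" "G = (\<lambda>x. \<Sum>e\<le>E. g e x)"
    using assms unfolding polynomial_upto_def by blast
  then show ?thesis unfolding polynomial_upto_def
    by (intro exI[of _ "\<lambda>e x. f e x + g e x"]) (simp add: form_add sum.distrib)
qed

lemma polynomial_upto_sum:
  "(\<And>a. a \<in> A \<Longrightarrow> polynomial_upto E (F a)) \<Longrightarrow> polynomial_upto E (\<lambda>x. \<Sum>a\<in>A. F a x)"
  by (induction A rule: infinite_finite_induct)
    (auto intro: polynomial_upto_add polynomial_upto_form[OF form_zero, of 0])

lemma polynomial_upto_mono:
  assumes "polynomial_upto E F" "E \<le> E'" shows "polynomial_upto E' F"
proof -
  obtain f where f: "\<forall>e. form e (f e)" "F = (\<lambda>x. \<Sum>e\<le>E. f e x)"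
    using assms unfolding polynomial_upto_def by blast
  show ?thesis unfolding f(2)
    by (rule polynomial_upto_sum) (use f assms(2) in \<open>auto intro: polynomial_upto_form\<close>)
qed

lemma polynomial_fun_form: "form d F \<Longrightarrow> polynomial_fun F"
  using polynomial_upto_form[of d F d] by (auto simp: polynomial_fun_def)

lemma polynomial_fun_add:
  assumes "polynomial_fun F" "polynomial_fun G" shows "polynomial_fun (\<lambda>x. F x + G x)"
proof -
  obtain D E where "polynomial_upto D F" "polynomial_upto E G"
    using assms by (auto simp: polynomial_fun_def)
  then have "polynomial_upto (D + E) F" "polynomial_upto (D + E) G"
    by (auto elim: polynomial_upto_mono)
  then show ?thesis by (auto simp: polynomial_fun_def intro: polynomial_upto_add)
qed

lemma polynomial_fun_sum:
  "(\<And>a. a \<in> A \<Longrightarrow> polynomial_fun (F a)) \<Longrightarrow> polynomial_fun (\<lambda>x. \<Sum>a\<in>A. F a x)"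
  by (induction A rule: infinite_finite_induct)
    (auto intro: polynomial_fun_add polynomial_fun_form[OF form_const])

lemma polynomial_fun_mult:
  assumes "polynomial_fun F" "polynomial_fun G" shows "polynomial_fun (\<lambda>x. F x * G x)"
proof -
  obtain D E f g where f: "\<And>e. form e (f e)" "F = (\<lambda>x. \<Sum>e\<le>D. f e x)"
    and g: "\<And>e. form e (g e)" "G = (\<lambda>x. \<Sum>e\<le>E. g e x)"
    using assms unfolding polynomial_fun_def polynomial_upto_def by blast
  show ?thesis unfolding f(2) g(2) sum_product
    by (rule polynomial_fun_sum, rule polynomial_fun_sum)
      (rule polynomial_fun_form[OF form_mult[OF f(1) g(1)]])
qed

lemma polynomial_fun_const: "polynomial_fun (\<lambda>_. a)"
  by (rule polynomial_fun_form[OF form_const])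

lemma polynomial_fun_coordinate: "polynomial_fun (\<lambda>x. x $ i)"
  by (rule polynomial_fun_form[OF form_coordinate])

lemma polynomial_fun_diff:
  "polynomial_fun F \<Longrightarrow> polynomial_fun G \<Longrightarrow> polynomial_fun (\<lambda>x. F x - G x)"
  using polynomial_fun_add[of F "\<lambda>x. (-1) * G x"] polynomial_fun_mult[of "\<lambda>_. -1" G]
  by (simp add: polynomial_fun_const)

lemma polynomial_fun_poly:
  "polynomial_fun F \<Longrightarrow> polynomial_fun (\<lambda>x. poly g (F x))"
  by (induction g) (auto intro!: polynomial_fun_const polynomial_fun_add polynomial_fun_mult)

inductive_set ideal_span ::
  "(complex^('n::finite) \<Rightarrow> complex) set \<Rightarrow> (complex^'n \<Rightarrow> complex) set" for S where
  zero: "(\<lambda>_. 0) \<in> ideal_span S"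
| step: "f \<in> S \<Longrightarrow> polynomial_fun q \<Longrightarrow> g \<in> ideal_span S
    \<Longrightarrow> (\<lambda>x. q x * f x + g x) \<in> ideal_span S"

lemma ideal_span_base: "f \<in> S \<Longrightarrow> f \<in> ideal_span S"
  using ideal_span.step[of f S "\<lambda>_. 1" "\<lambda>_. 0"]
  by (simp add: polynomial_fun_const ideal_span.zero)

lemma ideal_span_add:
  assumes "f \<in> ideal_span S" "g \<in> ideal_span S" shows "(\<lambda>x. f x + g x) \<in> ideal_span S"
  using assms(1)
proof induction
  case (step f q h)
  from ideal_span.step[OF step(1,2,4)] show ?case by (simp add: add.assoc)
qed (use assms(2) in simp)

lemma ideal_span_mult:
  assumes "f \<in> ideal_span S" "polynomial_fun r" shows "(\<lambda>x. r x * f x) \<in> ideal_span S"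
  using assms(1)
proof induction
  case (step f q h)
  from ideal_span.step[OF step(1) polynomial_fun_mult[OF assms(2) step(2)] step(4)]
  show ?case by (simp add: algebra_simps)
qed (simp add: ideal_span.zero)

lemma ideal_span_sum:
  "(\<And>a. a \<in> A \<Longrightarrow> F a \<in> ideal_span S) \<Longrightarrow> (\<lambda>x. \<Sum>a\<in>A. F a x) \<in> ideal_span S"
  by (induction A rule: infinite_finite_induct) (auto intro: ideal_span.zero ideal_span_add)

lemma ideal_span_insertD:
  assumes "h \<in> ideal_span (insert t S)"
  shows "\<exists>m q. m \<in> ideal_span S \<and> polynomial_fun q \<and> h = (\<lambda>x. m x + q x * t x)"
  using assms
proof induction
  case zero
  then show ?case
    by (intro exI[of _ "\<lambda>_. 0"]) (simp add: ideal_span.zero polynomial_fun_const)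
next
  case (step f q g)
  then obtain m r where m: "m \<in> ideal_span S" "polynomial_fun r" "g = (\<lambda>x. m x + r x * t x)"
    by blast
  show ?case
  proof (cases "f = t")
    case True
    then show ?thesis using m step(2)
      by (intro exI[of _ m] exI[of _ "\<lambda>x. q x + r x"]) (auto intro: polynomial_fun_add simp: algebra_simps)
  next
    case False
    then have "(\<lambda>x. q x * f x + m x) \<in> ideal_span S" using step m by (auto intro: ideal_span.step)
    then show ?thesis using m
      by (intro exI[of _ "\<lambda>x. q x * f x + m x"] exI[of _ r]) (auto simp: algebra_simps)
  qed
qed

text \<open>
  If adjoining \<open>x $ i - c\<close> to a proper ideal \<open>I\<close> gives the unit ideal for all \<open>c\<close>, then every
  \<open>x $ i - c\<close> is invertible modulo \<open>I\<close>. There are uncountably many inverses, but polynomials form a space of countable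
  dimension, so finitely many inverses are linearly dependent. Clearing denominators in the
  dependency gives a nonzero polynomial in \<open>x $ i\<close> alone that lies in \<open>I\<close>; it is a product of
  linear factors, all invertible modulo \<open>I\<close>, so \<open>I\<close> is not proper.
\<close>

lemma adjoin_coordinate_value:
  fixes S :: "(complex^('n::finite) \<Rightarrow> complex) set"
  assumes proper: "(\<lambda>_. 1) \<notin> ideal_span S"
  shows "\<exists>c. (\<lambda>_. 1) \<notin> ideal_span (insert (\<lambda>x. x $ i - c) S)"
proof (rule ccontr)
  assume "\<not> ?thesis"
  then have "\<forall>c. \<exists>m q. m \<in> ideal_span S \<and> polynomial_fun q \<and>
      (\<lambda>_. 1) = (\<lambda>x. m x + q x * (x $ i - c))"
    by (blast dest: ideal_span_insertD)
  then obtain m q where mq: "\<And>c. m c \<in> ideal_span S" "\<And>c. polynomial_fun (q c)"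
      "\<And>c. (\<lambda>_. 1) = (\<lambda>x. m c x + q c x * (x $ i - c))"
    by metis
  have one: "1 = m c x + q c x * (x $ i - c)" for c x using mq(3)[of c] by metis
  have no_poly: "(\<lambda>x. poly g (x $ i)) \<notin> ideal_span S" if "g \<noteq> 0" for g
    using that
  proof (induction "degree g" arbitrary: g rule: less_induct)
    case less
    show ?case
    proof (cases "degree g = 0")
      case True
      then obtain a where a: "g = [:a:]" by (auto elim: degree_eq_zeroE)
      show ?thesis
      proof
        assume "(\<lambda>x. poly g (x $ i)) \<in> ideal_span S"
        from ideal_span_mult[OF this polynomial_fun_const[of "1 / a"]] a less.prems proper
        show False by simp
      qed
    next
      case False
      then obtain e where "poly g e = 0"
        using fundamental_theorem_of_algebra[of g] by (auto simp: constant_degree)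
      then obtain h where h: "g = [:- e, 1:] * h" by (auto simp: poly_eq_0_iff_dvd)
      then have h0: "h \<noteq> 0" using less.prems by auto
      have deg: "degree h < degree g" unfolding h using h0 by (subst degree_mult_eq) auto
      show ?thesis
      proof
        assume g: "(\<lambda>x. poly g (x $ i)) \<in> ideal_span S"
        have p: "polynomial_fun (\<lambda>x. poly h (x $ i))"
          by (intro polynomial_fun_poly polynomial_fun_coordinate)
        have "(\<lambda>x. poly h (x $ i) * m e x + q e x * poly g (x $ i)) \<in> ideal_span S"
          by (rule ideal_span_add[OF ideal_span_mult[OF mq(1) p] ideal_span_mult[OF g mq(2)]])
        also have "(\<lambda>x. poly h (x $ i) * m e x + q e x * poly g (x $ i)) = (\<lambda>x. poly h (x $ i))"
        proof
          fix x
          have "poly h (x $ i) * m e x + q e x * poly g (x $ i)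
              = poly h (x $ i) * (m e x + q e x * (x $ i - e))"
            by (simp add: h algebra_simps)
          then show "poly h (x $ i) * m e x + q e x * poly g (x $ i) = poly h (x $ i)"
            using one[of e x] by simp
        qed
        finally show False using less.hyps[OF deg h0] by simp
      qed
    qed
  qed
  obtain E where E: "\<And>c. polynomial_upto (E c) (q c)"
    using mq(2) unfolding polynomial_fun_def by metis
  \<comment> \<open>One degree bound serves infinitely many \<open>c\<close>, so more inverses than power products are available.\<close>
  have "\<exists>e. infinite {c. E c = e}"
  proof (rule ccontr)
    assume "\<not> ?thesis"
    then have "countable (\<Union>e. {c. E c = e})" by (auto intro: countable_finite)
    moreover have "(\<Union>e. {c. E c = e}) = UNIV" by auto
    ultimately show False using uncountable_UNIV_complex by simp
  qed
  then obtain e where e: "infinite {c. E c = e}" by blast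
  define I :: "('n \<Rightarrow> nat) set" where "I = (\<Union>d\<le>e. exponents d)"
  have finI: "finite I" by (simp add: I_def)
  have "\<exists>M. \<forall>x. q c x = (\<Sum>\<alpha>\<in>I. M \<alpha> * power_product \<alpha> x)" if "E c = e" for c
  proof -
    obtain f where f: "\<forall>d. form d (f d)" "q c = (\<lambda>x. \<Sum>d\<le>e. f d x)"
      using E[of c] \<open>E c = e\<close> unfolding polynomial_upto_def by blast
    have "\<forall>d. \<exists>b. f d = form_of d b" using f(1) by (simp add: form_iff)
    then obtain b where b: "\<And>d. f d = form_of d (b d)" by metis
    have "q c x = (\<Sum>\<alpha>\<in>I. b (sum \<alpha> UNIV) \<alpha> * power_product \<alpha> x)" for x
    proof -
      have "(\<Sum>\<alpha>\<in>I. b (sum \<alpha> UNIV) \<alpha> * power_product \<alpha> x)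
          = (\<Sum>d\<le>e. \<Sum>\<alpha>\<in>exponents d. b (sum \<alpha> UNIV) \<alpha> * power_product \<alpha> x)"
        unfolding I_def by (rule sum.UNION_disjoint) (auto simp: exponents_def finite_exponents)
      also have "\<dots> = (\<Sum>d\<le>e. f d x)"
        unfolding b form_of_def by (intro sum.cong) (auto simp: exponents_def)
      finally show ?thesis by (simp add: f)
    qed
    then show ?thesis by (intro exI allI)
  qed
  then obtain M where M: "\<And>c x. E c = e \<Longrightarrow> q c x = (\<Sum>\<alpha>\<in>I. M c \<alpha> * power_product \<alpha> x)"
    by metis
  obtain K where K: "K \<subseteq> {c. E c = e}" "finite K" "card K = Suc (card I)"
    using infinite_arbitrarily_large[OF e] by blast
  then obtain a k\<^sub>0 where a: "k\<^sub>0 \<in> K" "a k\<^sub>0 \<noteq> 0" "\<forall>\<alpha>\<in>I. (\<Sum>k\<in>K. a k * M k \<alpha>) = 0"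
    using dependent_if_card_less[OF finI K(2), of M] by auto
  have rel: "(\<Sum>k\<in>K. a k * q k x) = 0" for x
  proof -
    have "(\<Sum>k\<in>K. a k * q k x) = (\<Sum>k\<in>K. \<Sum>\<alpha>\<in>I. a k * M k \<alpha> * power_product \<alpha> x)"
      using K(1) by (intro sum.cong) (auto simp: M sum_distrib_left mult.assoc)
    also have "\<dots> = (\<Sum>\<alpha>\<in>I. (\<Sum>k\<in>K. a k * M k \<alpha>) * power_product \<alpha> x)"
      by (subst sum.swap) (simp add: sum_distrib_right)
    finally show ?thesis using a(3) by simp
  qed
  define g where "g = (\<Sum>k\<in>K. smult (a k) (\<Prod>l\<in>K - {k}. [:- l, 1:]))"
  have g: "poly g z = (\<Sum>k\<in>K. a k * (\<Prod>l\<in>K - {k}. z - l))" for z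
    by (simp add: g_def poly_sum poly_prod)
  have "poly g k\<^sub>0 = a k\<^sub>0 * (\<Prod>l\<in>K - {k\<^sub>0}. k\<^sub>0 - l)"
  proof -
    have "(\<Prod>l\<in>K - {k}. k\<^sub>0 - l) = 0" if "k \<in> K - {k\<^sub>0}" for k
      using that K(2) a(1) by (intro prod_zero) auto
    then have "(\<Sum>k\<in>K - {k\<^sub>0}. a k * (\<Prod>l\<in>K - {k}. k\<^sub>0 - l)) = 0"
      by (intro sum.neutral) (metis mult_zero_right)
    then show ?thesis unfolding g by (subst sum.remove[OF K(2) a(1)]) simp
  qed
  then have "g \<noteq> 0" using a K(2) by auto
  moreover have "(\<lambda>x. poly g (x $ i)) \<in> ideal_span S"
  proof -
    have "(\<lambda>x. \<Sum>k\<in>K. poly (smult (a k) (\<Prod>l\<in>K - {k}. [:- l, 1:])) (x $ i) * m k x) \<in> ideal_span S"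
      by (rule ideal_span_sum)
        (rule ideal_span_mult[OF mq(1) polynomial_fun_poly[OF polynomial_fun_coordinate]])
    also have "(\<lambda>x. \<Sum>k\<in>K. poly (smult (a k) (\<Prod>l\<in>K - {k}. [:- l, 1:])) (x $ i) * m k x)
        = (\<lambda>x. poly g (x $ i))"
    proof
      fix x
      have "poly g (x $ i) = (\<Sum>k\<in>K. a k * (\<Prod>l\<in>K - {k}. x $ i - l) * m k x
          + (\<Prod>l\<in>K. x $ i - l) * (a k * q k x))"
        unfolding g
      proof (intro sum.cong refl)
        fix k assume k: "k \<in> K"
        have "a k * (\<Prod>l\<in>K - {k}. x $ i - l)
            = a k * (\<Prod>l\<in>K - {k}. x $ i - l) * (m k x + q k x * (x $ i - k))"
          using one[of k x] by simp
        also have "\<dots> = a k * (\<Prod>l\<in>K - {k}. x $ i - l) * m k x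
          + ((x $ i - k) * (\<Prod>l\<in>K - {k}. x $ i - l)) * (a k * q k x)"
          by (simp add: algebra_simps)
        finally show "a k * (\<Prod>l\<in>K - {k}. x $ i - l) = a k * (\<Prod>l\<in>K - {k}. x $ i - l) * m k x
          + (\<Prod>l\<in>K. x $ i - l) * (a k * q k x)"
          using prod.remove[OF K(2) k, of "\<lambda>l. x $ i - l"] by simp
      qed
      also have "\<dots> = (\<Sum>k\<in>K. a k * (\<Prod>l\<in>K - {k}. x $ i - l) * m k x)
          + (\<Prod>l\<in>K. x $ i - l) * (\<Sum>k\<in>K. a k * q k x)"
        by (simp only: sum.distrib sum_distrib_left)
      finally show "(\<Sum>k\<in>K. poly (smult (a k) (\<Prod>l\<in>K - {k}. [:- l, 1:])) (x $ i) * m k x)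
          = poly g (x $ i)" by (simp add: rel poly_prod)
    qed
    finally show ?thesis .
  qed
  ultimately show False using no_poly by blast
qed

lemma ideal_span_cong_mult:
  assumes "(\<lambda>x. u x - a) \<in> ideal_span S" "(\<lambda>x. v x - b) \<in> ideal_span S" "polynomial_fun u"
  shows "(\<lambda>x. u x * v x - a * b) \<in> ideal_span S"
  using ideal_span_add[OF ideal_span_mult[OF assms(2,3)]
      ideal_span_mult[OF assms(1) polynomial_fun_const[of b]]]
  by (simp add: algebra_simps)

text \<open>
  Modulo the ideal every coordinate function is congruent to a constant, hence so is every
  polynomial.
\<close>

lemma polynomial_fun_cong_value:
  assumes coord: "\<And>i. (\<lambda>x. x $ i - a $ i) \<in> ideal_span S" and "polynomial_fun F"
  shows "(\<lambda>x. F x - F a) \<in> ideal_span S"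
proof -
  have pow: "(\<lambda>x. x $ i ^ n - a $ i ^ n) \<in> ideal_span S" for i n
    by (induction n)
      (auto intro: ideal_span.zero ideal_span_cong_mult[OF coord _ polynomial_fun_coordinate])
  have poly_pow: "polynomial_fun (\<lambda>x. x $ i ^ n)" for i n
    by (rule polynomial_fun_form[OF form_power[OF form_coordinate]])
  have pp: "(\<lambda>x. power_product \<alpha> x - power_product \<alpha> a) \<in> ideal_span S" for \<alpha>
  proof -
    have "(\<lambda>x. (\<Prod>i\<in>J. x $ i ^ \<alpha> i) - (\<Prod>i\<in>J. a $ i ^ \<alpha> i)) \<in> ideal_span S" if "finite J" for J
      using that by (induction J)
        (auto intro: ideal_span.zero ideal_span_cong_mult[OF pow _ poly_pow])
    then show ?thesis by (simp add: power_product_def)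
  qed
  obtain E f where f: "\<forall>d. form d (f d)" "F = (\<lambda>x. \<Sum>d\<le>E. f d x)"
    using assms(2) unfolding polynomial_fun_def polynomial_upto_def by blast
  have "\<forall>d. \<exists>b. f d = form_of d b" using f(1) by (simp add: form_iff)
  then obtain b where b: "\<And>d. f d = form_of d (b d)" by metis
  have "(\<lambda>x. \<Sum>d\<le>E. \<Sum>\<alpha>\<in>exponents d. b d \<alpha> * (power_product \<alpha> x - power_product \<alpha> a))
      \<in> ideal_span S"
    by (rule ideal_span_sum, rule ideal_span_sum) (rule ideal_span_mult[OF pp polynomial_fun_const])
  then show ?thesis by (simp add: f b form_of_def sum_subtractf right_diff_distrib)
qed

text \<open>
  Every coordinate can in turn be made congruent to a constant \<open>c i\<close> without making the ideal
  improper. Then each member \<open>f\<close> is congruent both to \<open>0\<close> and to its value at \<open>c\<close>, so this value is \<open>0\<close>.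
\<close>

theorem weak_nullstellensatz:
  fixes S :: "(complex^('n::finite) \<Rightarrow> complex) set"
  assumes "\<And>f. f \<in> S \<Longrightarrow> polynomial_fun f" "(\<lambda>_. 1) \<notin> ideal_span S"
  shows "\<exists>x. \<forall>f\<in>S. f x = 0"
proof -
  have "\<exists>c. (\<lambda>_. 1) \<notin> ideal_span (S \<union> (\<lambda>i x. x $ i - c i) ` J)" if "finite J" for J :: "'n set"
    using that
  proof induction
    case empty
    then show ?case using assms by simp
  next
    case (insert i J)
    then obtain c where c: "(\<lambda>_. 1) \<notin> ideal_span (S \<union> (\<lambda>i x. x $ i - c i) ` J)" by blast
    from adjoin_coordinate_value[OF this, of i] obtain z where
      z: "(\<lambda>_. 1) \<notin> ideal_span (insert (\<lambda>x. x $ i - z) (S \<union> (\<lambda>i x. x $ i - c i) ` J))" by blast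
    have "(\<lambda>j x. x $ j - (c(i := z)) j) ` J = (\<lambda>i x. x $ i - c i) ` J"
      using insert.hyps by (intro image_cong) auto
    then have "insert (\<lambda>x. x $ i - z) (S \<union> (\<lambda>i x. x $ i - c i) ` J)
        = S \<union> (\<lambda>j x. x $ j - (c(i := z)) j) ` insert i J" by simp
    with z show ?case by metis
  qed
  from this[of UNIV] obtain c where
    c: "(\<lambda>_. 1) \<notin> ideal_span (S \<union> range (\<lambda>i x. x $ i - c i))" by auto
  define T where "T = S \<union> range (\<lambda>i x. x $ i - c i)"
  define a where "a = (\<chi> i. c i)"
  have coord: "(\<lambda>x. x $ i - a $ i) \<in> ideal_span T" for i
    by (rule ideal_span_base) (auto simp: T_def a_def)
  have "f a = 0" if f: "f \<in> S" for f
  proof (rule ccontr)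
    assume "f a \<noteq> 0"
    have diff: "(\<lambda>x. f x - f a) \<in> ideal_span T"
      by (rule polynomial_fun_cong_value[OF coord assms(1)[OF f]])
    have "f \<in> ideal_span T" using f by (auto intro: ideal_span_base simp: T_def)
    from ideal_span_mult[OF ideal_span_add[OF this ideal_span_mult[OF diff polynomial_fun_const]]
        polynomial_fun_const]
    have "(\<lambda>x. (1 / f a) * (f x + (-1) * (f x - f a))) \<in> ideal_span T" .
    with c \<open>f a \<noteq> 0\<close> show False by (simp add: T_def)
  qed
  then show ?thesis by blast
qed

section \<open>Elimination theory\<close>

text \<open>
  The part of degree \<open>D\<close> of the homogeneous ideal generated by forms. The generators are given by
  their degrees and coefficients, since later it is the coefficients that depend on a parameter.
\<close>

inductive form_ideal :: "(nat \<times> (('n::finite \<Rightarrow> nat) \<Rightarrow> complex)) set \<Rightarrow> nat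
    \<Rightarrow> (complex^'n \<Rightarrow> complex) \<Rightarrow> bool" for S D where
  zero: "form_ideal S D (\<lambda>_. 0)"
| step: "(d, b) \<in> S \<Longrightarrow> d \<le> D \<Longrightarrow> form (D - d) q \<Longrightarrow> form_ideal S D g
    \<Longrightarrow> form_ideal S D (\<lambda>x. q x * form_of d b x + g x)"

lemma form_ideal_mult:
  assumes "form_ideal S D g" "form e r" shows "form_ideal S (D + e) (\<lambda>x. r x * g x)"
  using assms(1)
proof induction
  case (step d b q g)
  have "form (D + e - d) (\<lambda>x. r x * q x)"
    using form_mult[OF assms(2) step(3)] step(2) by (simp add: add.commute)
  from form_ideal.step[OF step(1) _ this step(5)] step(2) show ?case
    by (simp add: algebra_simps)
qed (simp add: form_ideal.zero)

text \<open>
  Homogenizing a member of the ideal generated by forms and \<open>x $ k - 1\<close>: substituting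
  \<open>x / x $ k\<close> kills the last generator, and a large power of \<open>x $ k\<close> clears denominators.
\<close>

lemma homogenize_ideal_span:
  assumes "h \<in> ideal_span ((\<lambda>(d, b). form_of d b) ` S \<union> {\<lambda>x. x $ k - 1})"
  shows "\<exists>D\<^sub>0. \<forall>D\<ge>D\<^sub>0. \<exists>g. form_ideal S D g \<and>
    (\<forall>x. x $ k \<noteq> 0 \<longrightarrow> g x = x $ k ^ D * h ((1 / x $ k) *s x))"
  using assms
proof induction
  case zero
  then show ?case by (auto intro!: exI[of _ "\<lambda>_. 0"] form_ideal.zero)
next
  case (step f q h)
  from step.IH obtain D\<^sub>0 where D\<^sub>0: "\<And>D. D \<ge> D\<^sub>0 \<Longrightarrow> \<exists>g. form_ideal S D g \<and>
    (\<forall>x. x $ k \<noteq> 0 \<longrightarrow> g x = x $ k ^ D * h ((1 / x $ k) *s x))" by blast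
  show ?case
  proof (cases "f = (\<lambda>x. x $ k - 1)")
    case True
    then show ?thesis using D\<^sub>0 by (intro exI[of _ D\<^sub>0]) simp
  next
    case False
    then obtain d b where f: "(d, b) \<in> S" "f = form_of d b" using step(1) by auto
    obtain E p where p: "\<And>e. form e (p e)" "q = (\<lambda>x. \<Sum>e\<le>E. p e x)"
      using step(2) unfolding polynomial_fun_def polynomial_upto_def by blast
    show ?thesis
    proof (intro exI[of _ "max D\<^sub>0 (d + E)"] allI impI)
      fix D assume D: "max D\<^sub>0 (d + E) \<le> D"
      then obtain g where g: "form_ideal S D g"
        "\<And>x. x $ k \<noteq> 0 \<Longrightarrow> g x = x $ k ^ D * h ((1 / x $ k) *s x)" using D\<^sub>0[of D] by auto
      define r where "r = (\<lambda>x. \<Sum>e\<le>E. x $ k ^ (D - d - e) * p e x)"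
      have "form (D - d) (\<lambda>x. x $ k ^ (D - d - e) * p e x)" if "e \<le> E" for e
      proof -
        have "form (D - d - e) (\<lambda>x. x $ k ^ (D - d - e))"
          using form_power[OF form_coordinate, of "D - d - e" k] by simp
        from form_mult[OF this p(1)[of e]] show ?thesis using D that by simp
      qed
      then have r: "form (D - d) r" unfolding r_def by (intro form_sum) simp
      have "r x * form_of d b x + g x = x $ k ^ D * (q ((1 / x $ k) *s x) * f ((1 / x $ k) *s x)
          + h ((1 / x $ k) *s x))" if x: "x $ k \<noteq> 0" for x
      proof -
        have "x $ k ^ (D - d) * p e ((1 / x $ k) *s x) = x $ k ^ (D - d - e) * p e x" if "e \<le> E" for e
        proof -
          have "x $ k ^ (D - d) = x $ k ^ (D - d - e) * x $ k ^ e"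
            using that D by (simp flip: power_add)
          then show ?thesis
            using x by (simp add: form_homogeneous[OF p(1)] power_one_over)
        qed
        then have r': "r x = x $ k ^ (D - d) * q ((1 / x $ k) *s x)"
          by (simp add: r_def p(2) sum_distrib_left)
        have f': "form_of d b x = x $ k ^ d * f ((1 / x $ k) *s x)"
          unfolding f using x by (simp add: form_homogeneous[OF form_of_form] power_one_over)
        have "x $ k ^ D = x $ k ^ (D - d) * x $ k ^ d" using D by (simp flip: power_add)
        then show ?thesis by (simp add: r' f' g(2)[OF x] algebra_simps)
      qed
      moreover have "form_ideal S D (\<lambda>x. r x * form_of d b x + g x)"
        by (rule form_ideal.step[OF f(1) _ r g(1)]) (use D in simp)
      ultimately show "\<exists>g. form_ideal S D g \<and> (\<forall>x. x $ k \<noteq> 0 \<longrightarrow> g x =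
          x $ k ^ D * (q ((1 / x $ k) *s x) * f ((1 / x $ k) *s x) + h ((1 / x $ k) *s x)))"
        by blast
    qed
  qed
qed

text \<open>
  The argument of Rabinowitsch: the forms have no common zero with \<open>x $ k = 1\<close>, so together with
  \<open>x $ k - 1\<close> they generate the unit ideal, and homogenizing \<open>1\<close> gives a power of \<open>x $ k\<close>.
\<close>

lemma coordinate_power_in_form_ideal:
  assumes "\<And>x. x \<noteq> 0 \<Longrightarrow> \<exists>(d, b)\<in>S. form_of d b x \<noteq> 0"
  shows "\<exists>D. form_ideal S D (\<lambda>x. x $ k ^ D)"
proof -
  let ?T = "(\<lambda>(d, b). form_of d b) ` S \<union> {\<lambda>x. x $ k - 1}"
  have "(\<lambda>_. 1) \<in> ideal_span ?T"
  proof (rule ccontr)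
    assume "(\<lambda>_. 1) \<notin> ideal_span ?T"
    moreover have "polynomial_fun f" if "f \<in> ?T" for f
      using that by (auto intro: polynomial_fun_diff polynomial_fun_coordinate
          polynomial_fun_const polynomial_fun_form[OF form_of_form])
    ultimately obtain x where x: "\<forall>f\<in>?T. f x = 0" using weak_nullstellensatz[of ?T] by blast
    then have "x $ k = 1" by simp
    then have "x \<noteq> 0" by auto
    from assms[OF this] x show False by auto
  qed
  from homogenize_ideal_span[OF this] obtain D g where g: "form_ideal S D g"
    "\<And>x. x $ k \<noteq> 0 \<Longrightarrow> g x = x $ k ^ D" by auto
  \<comment> \<open>The extra factor makes the identity valid on the hyperplane \<open>x $ k = 0\<close> as well.\<close>
  have "(\<lambda>x. x $ k * g x) = (\<lambda>x. x $ k ^ (D + 1))"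
  proof
    show "x $ k * g x = x $ k ^ (D + 1)" for x using g(2)[of x] by (cases "x $ k = 0") auto
  qed
  with form_ideal_mult[OF g(1) form_coordinate, of k] show ?thesis by metis
qed

text \<open>
  The projective Nullstellensatz: once every \<open>x $ k ^ M\<close> lies in the ideal, so does every power
  product of degree \<open>M\<close> times the number of variables, as one exponent must reach \<open>M\<close>.
\<close>

lemma projective_nullstellensatz:
  fixes S :: "(nat \<times> (('n::finite \<Rightarrow> nat) \<Rightarrow> complex)) set"
  assumes "\<And>x. x \<noteq> 0 \<Longrightarrow> \<exists>(d, b)\<in>S. form_of d b x \<noteq> 0"
  shows "\<exists>D. \<forall>\<alpha>\<in>exponents D. form_ideal S D (power_product \<alpha>)"
proof -
  from coordinate_power_in_form_ideal[OF assms] obtain m where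
    m: "\<And>k. form_ideal S (m k) (\<lambda>x. x $ k ^ m k)" by metis
  define M where "M = Max (range m)"
  have M: "m k \<le> M" for k by (simp add: M_def)
  define D where "D = CARD('n) * M"
  have "form_ideal S D (power_product \<alpha>)" if \<alpha>: "\<alpha> \<in> exponents D" for \<alpha>
  proof -
    have "\<exists>k. M \<le> \<alpha> k"
    proof (rule ccontr)
      assume "\<not> ?thesis"
      then have "sum \<alpha> UNIV < (\<Sum>k\<in>(UNIV::'n set). M)" by (intro sum_strict_mono) (auto simp: not_le)
      then show False using \<alpha> by (simp add: exponents_def D_def)
    qed
    then obtain k where k: "M \<le> \<alpha> k" by blast
    define \<beta> where "\<beta> = \<alpha>(k := \<alpha> k - m k)"
    have mk: "m k \<le> \<alpha> k" using k M[of k] by simp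
    have \<beta>: "sum \<beta> UNIV + m k = D"
    proof -
      have "sum \<beta> UNIV = (\<alpha> k - m k) + sum \<alpha> (UNIV - {k})"
        by (subst sum.remove[of _ k]) (auto simp: \<beta>_def intro!: sum.cong)
      moreover have "D = \<alpha> k + sum \<alpha> (UNIV - {k})"
        using \<alpha> by (simp add: exponents_def sum.remove[of _ k])
      ultimately show ?thesis using mk by simp
    qed
    have "power_product \<beta> x * x $ k ^ m k = power_product \<alpha> x" for x
    proof -
      have "power_product \<beta> x = x $ k ^ (\<alpha> k - m k) * (\<Prod>i\<in>UNIV - {k}. x $ i ^ \<alpha> i)"
        unfolding power_product_def by (subst prod.remove[of _ k]) (auto simp: \<beta>_def intro!: prod.cong)
      moreover have "power_product \<alpha> x = x $ k ^ \<alpha> k * (\<Prod>i\<in>UNIV - {k}. x $ i ^ \<alpha> i)"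
        unfolding power_product_def by (subst prod.remove[of _ k]) auto
      moreover have "x $ k ^ \<alpha> k = x $ k ^ (\<alpha> k - m k) * x $ k ^ m k"
        using mk by (simp flip: power_add)
      ultimately show ?thesis by simp
    qed
    moreover have "form_ideal S (m k + sum \<beta> UNIV) (\<lambda>x. power_product \<beta> x * x $ k ^ m k)"
      by (rule form_ideal_mult[OF m form_power_product]) (simp add: exponents_def)
    ultimately show ?thesis using \<beta> by (simp add: add.commute)
  qed
  then show ?thesis by blast
qed

text \<open>
  A vector \<open>v\<close> defines the linear functional sending a form with coefficients \<open>c\<close> to
  \<open>\<Sum>\<delta>. c \<delta> * v \<delta>\<close>. If it kills the multiples of the generators by power products, it kills the
  whole ideal in degree \<open>D\<close>.
\<close>

lemma form_ideal_annihilated: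
  fixes S :: "(nat \<times> (('n::finite \<Rightarrow> nat) \<Rightarrow> complex)) set" and v :: "('n \<Rightarrow> nat) \<Rightarrow> complex"
  assumes "form_ideal S D h"
    and v: "\<And>d b \<gamma>. (d, b) \<in> S \<Longrightarrow> d \<le> D \<Longrightarrow> \<gamma> \<in> exponents (D - d)
      \<Longrightarrow> (\<Sum>\<alpha>\<in>exponents d. b \<alpha> * v (\<lambda>i. \<gamma> i + \<alpha> i)) = 0"
  shows "\<exists>c. h = form_of D c \<and> (\<Sum>\<delta>\<in>exponents D. c \<delta> * v \<delta>) = 0"
  using assms(1)
proof induction
  case zero
  then show ?case by (intro exI[of _ "\<lambda>_. 0"]) (simp add: form_of_def)
next
  case (step d b q g)
  obtain c where c: "g = form_of D c" "(\<Sum>\<delta>\<in>exponents D. c \<delta> * v \<delta>) = 0" using step.IH by blast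
  obtain a where a: "q = form_of (D - d) a" using step(3) by (auto simp: form_iff)
  let ?P = "(exponents (D - d) :: ('n \<Rightarrow> nat) set) \<times> (exponents d :: ('n \<Rightarrow> nat) set)"
  define c' where "c' \<delta> = (\<Sum>(\<gamma>, \<alpha>)\<in>?P. if (\<lambda>i. \<gamma> i + \<alpha> i) = \<delta> then a \<gamma> * b \<alpha> else 0)" for \<delta>
  have c': "(\<Sum>\<delta>\<in>exponents D. c' \<delta> * w \<delta>)
      = (\<Sum>\<gamma>\<in>exponents (D - d). a \<gamma> * (\<Sum>\<alpha>\<in>exponents d. b \<alpha> * w (\<lambda>i. \<gamma> i + \<alpha> i)))"
    for w :: "('n \<Rightarrow> nat) \<Rightarrow> complex"
  proof -
    have "(\<Sum>\<delta>\<in>exponents D. c' \<delta> * w \<delta>) = (\<Sum>p\<in>?P. \<Sum>\<delta>\<in>exponents D.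
        if (\<lambda>i. fst p i + snd p i) = \<delta> then a (fst p) * b (snd p) * w \<delta> else 0)"
      unfolding c'_def sum_distrib_right
      by (subst sum.swap) (auto intro!: sum.cong simp: case_prod_beta)
    also have "\<dots> = (\<Sum>p\<in>?P. a (fst p) * b (snd p) * w (\<lambda>i. fst p i + snd p i))"
    proof (intro sum.cong refl)
      fix p assume "p \<in> ?P"
      then have "(\<lambda>i. fst p i + snd p i) \<in> exponents D"
        using exponents_add[of "fst p" "D - d" "snd p" d] step(2) by auto
      then show "(\<Sum>\<delta>\<in>exponents D.
          if (\<lambda>i. fst p i + snd p i) = \<delta> then a (fst p) * b (snd p) * w \<delta> else 0)
          = a (fst p) * b (snd p) * w (\<lambda>i. fst p i + snd p i)"
        by (subst sum.delta') auto
    qed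
    also have "\<dots> = (\<Sum>\<gamma>\<in>exponents (D - d). a \<gamma> * (\<Sum>\<alpha>\<in>exponents d. b \<alpha> * w (\<lambda>i. \<gamma> i + \<alpha> i)))"
      by (simp add: sum.cartesian_product' sum_distrib_left mult.assoc case_prod_beta)
    finally show ?thesis .
  qed
  have "q x * form_of d b x + g x = form_of D (\<lambda>\<delta>. c' \<delta> + c \<delta>) x" for x
  proof -
    have "form_of D (\<lambda>\<delta>. c' \<delta> + c \<delta>) x
        = (\<Sum>\<delta>\<in>exponents D. c' \<delta> * power_product \<delta> x) + g x"
      by (simp add: form_of_def c(1) distrib_right sum.distrib)
    also have "(\<Sum>\<delta>\<in>exponents D. c' \<delta> * power_product \<delta> x) = q x * form_of d b x"
      unfolding c' by (simp add: a form_of_def power_product_add sum_product sum_distrib_left mult_ac)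
    finally show ?thesis by simp
  qed
  moreover have "(\<Sum>\<delta>\<in>exponents D. (c' \<delta> + c \<delta>) * v \<delta>) = 0"
    using c(2) c'[of v] v[OF step(1,2)] by (simp add: distrib_right sum.distrib)
  ultimately show ?case by blast
qed

text \<open>
  The main theorem of elimination theory. If the forms have no common zero at \<open>y\<^sub>0\<close>, they
  generate all forms of some degree \<open>D\<close> there. Dually, a vector \<open>v\<close> indexed by power products of
  degree \<open>D\<close> that annihilates all multiples of the forms is zero. This is a linear system for
  \<open>v\<close> whose coefficients are forms in \<open>y\<close>, so it keeps having only the trivial solution on a
  principal open set; a common zero \<open>x\<close> would give the solution \<open>v \<delta> = x ^ \<delta>\<close>.
\<close>

theorem no_common_zero_open:
  fixes B :: "(nat \<times> (('m::finite \<Rightarrow> nat) \<Rightarrow> complex^('n::finite) \<Rightarrow> complex)) set"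
  assumes forms: "\<And>d b. (d, b) \<in> B \<Longrightarrow> \<exists>e. \<forall>\<alpha>. form e (b \<alpha>)"
    and no_zero: "\<And>x. x \<noteq> 0 \<Longrightarrow> \<exists>(d, b)\<in>B. form_of d (\<lambda>\<alpha>. b \<alpha> y\<^sub>0) x \<noteq> 0"
  shows "\<exists>e P. form e P \<and> P y\<^sub>0 \<noteq> 0 \<and>
    (\<forall>y x. P y \<noteq> 0 \<longrightarrow> x \<noteq> 0 \<longrightarrow> (\<exists>(d, b)\<in>B. form_of d (\<lambda>\<alpha>. b \<alpha> y) x \<noteq> 0))"
proof -
  define S where "S = (\<lambda>(d, b). (d, \<lambda>\<alpha>. b \<alpha> y\<^sub>0)) ` B"
  have "\<exists>(d, b)\<in>S. form_of d b x \<noteq> 0" if "x \<noteq> 0" for x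
    using no_zero[OF that] by (force simp: S_def)
  then obtain D where D: "\<And>\<alpha>. \<alpha> \<in> exponents D \<Longrightarrow> form_ideal S D (power_product \<alpha>)"
    using projective_nullstellensatz[of S] by blast
  define row where "row \<gamma> b = (\<lambda>\<delta> y. if \<forall>i. \<gamma> i \<le> \<delta> i then b (\<lambda>i. \<delta> i - \<gamma> i) y else 0)"
    for \<gamma> :: "'m \<Rightarrow> nat" and b :: "('m \<Rightarrow> nat) \<Rightarrow> complex^'n \<Rightarrow> complex"
  define R where "R = {row \<gamma> b | d b \<gamma>. (d, b) \<in> B \<and> d \<le> D \<and> \<gamma> \<in> exponents (D - d)}"
  have row: "(\<Sum>\<delta>\<in>exponents D. row \<gamma> b \<delta> y * v \<delta>)
      = (\<Sum>\<alpha>\<in>exponents d. b \<alpha> y * v (\<lambda>i. \<gamma> i + \<alpha> i))"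
    if "d \<le> D" "\<gamma> \<in> exponents (D - d)" for d b \<gamma> y v
  proof -
    have "(\<Sum>\<delta>\<in>exponents D. row \<gamma> b \<delta> y * v \<delta>)
        = (\<Sum>\<delta>\<in>{\<delta> \<in> exponents D. \<forall>i. \<gamma> i \<le> \<delta> i}. b (\<lambda>i. \<delta> i - \<gamma> i) y * v \<delta>)"
      by (rule sum.mono_neutral_cong_right) (auto simp: row_def)
    also have "\<dots> = (\<Sum>\<alpha>\<in>exponents d. b \<alpha> y * v (\<lambda>i. \<gamma> i + \<alpha> i))"
    proof (rule sum.reindex_bij_witness[of _ "\<lambda>\<alpha> i. \<gamma> i + \<alpha> i" "\<lambda>\<delta> i. \<delta> i - \<gamma> i"])
      fix \<delta> assume \<delta>: "\<delta> \<in> {\<delta> \<in> exponents D. \<forall>i. \<gamma> i \<le> \<delta> i}"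
      then show "(\<lambda>i. \<delta> i - \<gamma> i) \<in> exponents d"
        using that by (auto simp: exponents_def sum_subtractf_nat)
    qed (use that in \<open>auto simp: exponents_def sum.distrib\<close>)
    finally show ?thesis .
  qed
  have rows: "\<forall>r\<in>R. \<exists>e. \<forall>\<delta>. form e (r \<delta>)"
  proof
    fix r assume "r \<in> R"
    then obtain d b \<gamma> where r: "r = row \<gamma> b" "(d, b) \<in> B" unfolding R_def by blast
    then obtain e where e: "\<And>\<alpha>. form e (b \<alpha>)" using forms by blast
    have "form e (r \<delta>)" for \<delta>
    proof (cases "\<forall>i. \<gamma> i \<le> \<delta> i")
      case True
      then have "r \<delta> = b (\<lambda>i. \<delta> i - \<gamma> i)" by (simp add: r(1) row_def)
      then show ?thesis by (simp add: e)
    next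
      case False
      then have "r \<delta> = (\<lambda>_. 0)" by (simp only: r(1) row_def if_False)
      then show ?thesis by (simp add: form_zero)
    qed
    then show "\<exists>e. \<forall>\<delta>. form e (r \<delta>)" by blast
  qed
  have trivial: "\<forall>v. (\<forall>r\<in>R. (\<Sum>\<delta>\<in>exponents D. r \<delta> y\<^sub>0 * v \<delta>) = 0) \<longrightarrow> (\<forall>\<delta>\<in>exponents D. v \<delta> = 0)"
  proof (intro allI impI ballI)
    fix v and \<delta>\<^sub>0 :: "'m \<Rightarrow> nat"
    assume v: "\<forall>r\<in>R. (\<Sum>\<delta>\<in>exponents D. r \<delta> y\<^sub>0 * v \<delta>) = 0" and \<delta>\<^sub>0: "\<delta>\<^sub>0 \<in> exponents D"
    have "(\<Sum>\<alpha>\<in>exponents d. b \<alpha> * v (\<lambda>i. \<gamma> i + \<alpha> i)) = 0"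
      if "(d, b) \<in> S" "d \<le> D" "\<gamma> \<in> exponents (D - d)" for d b \<gamma>
    proof -
      obtain b' where b': "(d, b') \<in> B" "b = (\<lambda>\<alpha>. b' \<alpha> y\<^sub>0)" using \<open>(d, b) \<in> S\<close> by (auto simp: S_def)
      then have "row \<gamma> b' \<in> R" using that unfolding R_def by blast
      then show ?thesis using v row[OF that(2,3), of b' y\<^sub>0 v] b'(2) by simp
    qed
    from form_ideal_annihilated[OF D[OF \<delta>\<^sub>0] this] obtain c where
      c: "power_product \<delta>\<^sub>0 = form_of D c" "(\<Sum>\<delta>\<in>exponents D. c \<delta> * v \<delta>) = 0" by blast
    \<comment> \<open>Comparing coefficients, \<open>c\<close> is the indicator of \<open>\<delta>\<^sub>0\<close>, so the functional takes the value \<open>v \<delta>\<^sub>0\<close>.\<close>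
    have "(\<Sum>\<delta>\<in>exponents D. (c \<delta> - (if \<delta> = \<delta>\<^sub>0 then 1 else 0)) * power_product \<delta> x) = 0" for x
    proof -
      have "(\<Sum>\<delta>\<in>exponents D. (if \<delta> = \<delta>\<^sub>0 then 1 else 0) * power_product \<delta> x)
          = (\<Sum>\<delta>\<in>exponents D. if \<delta> = \<delta>\<^sub>0 then power_product \<delta> x else 0)"
        by (intro sum.cong) auto
      also have "\<dots> = form_of D c x" using \<delta>\<^sub>0 c(1) by simp
      finally show ?thesis by (simp only: left_diff_distrib sum_subtractf form_of_def) simp
    qed
    then have c\<delta>: "c \<delta> = (if \<delta> = \<delta>\<^sub>0 then 1 else 0)" if "\<delta> \<in> exponents D" for \<delta>
      using power_products_independent[of "exponents D" "\<lambda>\<delta>. c \<delta> - (if \<delta> = \<delta>\<^sub>0 then 1 else 0)"] that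
      by auto
    have "(\<Sum>\<delta>\<in>exponents D. c \<delta> * v \<delta>) = (\<Sum>\<delta>\<in>exponents D. if \<delta> = \<delta>\<^sub>0 then v \<delta> else 0)"
      by (intro sum.cong) (auto simp: c\<delta>)
    then show "v \<delta>\<^sub>0 = 0" using c(2) \<delta>\<^sub>0 by simp
  qed
  from only_trivial_solution_open[OF finite_exponents' rows trivial]
  obtain e P where P: "form e P" "P y\<^sub>0 \<noteq> 0"
    "\<And>y v. P y \<noteq> 0 \<Longrightarrow> \<forall>r\<in>R. (\<Sum>\<delta>\<in>exponents D. r \<delta> y * v \<delta>) = 0 \<Longrightarrow> \<forall>\<delta>\<in>exponents D. v \<delta> = 0"
    by blast
  have "\<exists>(d, b)\<in>B. form_of d (\<lambda>\<alpha>. b \<alpha> y) x \<noteq> 0" if y: "P y \<noteq> 0" and x: "x \<noteq> 0" for y x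
  proof (rule ccontr)
    assume "\<not> ?thesis"
    then have zero: "form_of d (\<lambda>\<alpha>. b \<alpha> y) x = 0" if "(d, b) \<in> B" for d b using that by blast
    have "\<forall>r\<in>R. (\<Sum>\<delta>\<in>exponents D. r \<delta> y * power_product \<delta> x) = 0"
    proof
      fix r assume "r \<in> R"
      then obtain d b \<gamma> where r: "r = row \<gamma> b" "(d, b) \<in> B" "d \<le> D" "\<gamma> \<in> exponents (D - d)"
        unfolding R_def by blast
      have "(\<Sum>\<alpha>\<in>exponents d. b \<alpha> y * power_product (\<lambda>i. \<gamma> i + \<alpha> i) x)
          = power_product \<gamma> x * form_of d (\<lambda>\<alpha>. b \<alpha> y) x"
        by (simp add: form_of_def power_product_add sum_distrib_left mult_ac)
      then show "(\<Sum>\<delta>\<in>exponents D. r \<delta> y * power_product \<delta> x) = 0"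
        using zero[OF r(2)] by (simp add: r(1) row[OF r(3,4)])
    qed
    from P(3)[OF y this] have pp: "\<forall>\<delta>\<in>exponents D. power_product \<delta> x = 0" .
    obtain k where k: "x $ k \<noteq> 0" using x by (auto simp: vec_eq_iff)
    define \<delta> where "\<delta> i = (if i = k then D else 0)" for i
    have "\<delta> \<in> exponents D" by (simp add: exponents_def \<delta>_def)
    moreover have "power_product \<delta> x = x $ k ^ D"
    proof -
      have "power_product \<delta> x = (\<Prod>i\<in>UNIV. if i = k then x $ k ^ D else 1)"
        unfolding power_product_def by (intro prod.cong) (auto simp: \<delta>_def)
      then show ?thesis by simp
    qed
    ultimately show False using pp k by auto
  qed
  with P show ?thesis by blast
qed

section \<open>Closed sets and morphisms\<close>

definition point_of :: "complex^('n::finite) \<Rightarrow> 'n cproj" where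
  "point_of v = Proj (vec.span {v})"

lemma homog_coords_point_of: "v \<noteq> 0 \<Longrightarrow> v \<in> homog_coords (point_of v)"
  by (simp add: homog_coords_def point_of_def Proj_inverse vec.subspace_span vec.span_base)

lemma homog_coords_nonzero: "v \<in> homog_coords p \<Longrightarrow> v \<noteq> 0"
  by (simp add: homog_coords_def)

lemma homog_coords_scale_iff:
  assumes "v \<in> homog_coords p" shows "w \<in> homog_coords p \<longleftrightarrow> (\<exists>a. a \<noteq> 0 \<and> w = a *s v)"
proof -
  have "w \<in> homog_coords p \<longleftrightarrow> (\<exists>a. w = a *s v) \<and> w \<noteq> 0"
    unfolding homog_coords_def line_of_eq_span[OF assms] vec.span_singleton by blast
  then show ?thesis using homog_coords_nonzero[OF assms] by (metis vec.scale_eq_0_iff)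
qed

lemma homog_coords_exists: "\<exists>v. v \<in> homog_coords p"
proof (rule ccontr)
  assume "\<not> ?thesis"
  then have "line_of p \<subseteq> {0}" by (auto simp: homog_coords_def)
  then have "vec.dim (line_of p) \<le> vec.dim {0 :: complex^'a}" by (rule vec.dim_subset)
  also have "\<dots> = 0" by (metis vec.dim_empty vec.dim_span vec.span_empty)
  finally show False using line_of[of p] by (simp del: vec.dim_eq_0)
qed

lemma homog_coords_unique: "v \<in> homog_coords p \<Longrightarrow> v \<in> homog_coords q \<Longrightarrow> p = q"
  by (metis line_of_eq_span line_of_inject)

lemma vanishes_at_iff:
  assumes F: "form d F" and v: "v \<in> homog_coords p"
  shows "vanishes_at F p \<longleftrightarrow> F v = 0"
proof
  assume "F v = 0"
  have "F w = 0" if "w \<in> homog_coords p" for w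
  proof -
    obtain a where "w = a *s v" using homog_coords_scale_iff[OF v] \<open>w \<in> homog_coords p\<close> by blast
    then show ?thesis using \<open>F v = 0\<close> by (simp add: form_homogeneous[OF F])
  qed
  then show "vanishes_at F p" by (simp add: vanishes_at_def)
qed (use v in \<open>simp add: vanishes_at_def\<close>)

lemma zariski_closed_separation:
  assumes "zariski_closed S" "p \<notin> S" "v \<in> homog_coords p"
  shows "\<exists>d F. form d F \<and> F v \<noteq> 0 \<and> (\<forall>q\<in>S. \<forall>w\<in>homog_coords q. F w = 0)"
proof -
  obtain \<F> where \<F>: "\<forall>F\<in>\<F>. \<exists>d. form d F" "S = {p. \<forall>F\<in>\<F>. vanishes_at F p}"
    using assms(1) unfolding zariski_closed_def by blast
  then obtain F d where F: "F \<in> \<F>" "form d F" "\<not> vanishes_at F p" using assms(2) by blast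
  have "F w = 0" if "q \<in> S" "w \<in> homog_coords q" for q w
    using that F(1) unfolding \<F>(2) vanishes_at_def by blast
  with F(2,3) show ?thesis using vanishes_at_iff[OF F(2) assms(3)] by blast
qed

lemma zariski_closedI:
  assumes "\<And>p v. p \<notin> S \<Longrightarrow> v \<in> homog_coords p \<Longrightarrow>
    \<exists>d F. form d F \<and> F v \<noteq> 0 \<and> (\<forall>q\<in>S. \<forall>w\<in>homog_coords q. F w = 0)"
  shows "zariski_closed S"
  unfolding zariski_closed_def
proof (intro exI conjI)
  let ?\<F> = "{F. (\<exists>d. form d F) \<and> (\<forall>q\<in>S. vanishes_at F q)}"
  show "\<forall>F\<in>?\<F>. \<exists>d. form d F" by blast
  have "p \<in> S" if p: "\<forall>F\<in>?\<F>. vanishes_at F p" for p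
  proof (rule ccontr)
    assume "p \<notin> S"
    moreover obtain v where v: "v \<in> homog_coords p" using homog_coords_exists by blast
    ultimately obtain d F where "form d F" "F v \<noteq> 0" "\<forall>q\<in>S. vanishes_at F q"
      using assms[of p v] unfolding vanishes_at_def by blast
    with p v show False unfolding vanishes_at_def by blast
  qed
  then show "S = {p. \<forall>F\<in>?\<F>. vanishes_at F p}" by blast
qed

lemma morphism_on_apply: "morphism_on X Y f \<Longrightarrow> x \<in> X \<Longrightarrow> f x \<in> Y"
  by (auto simp: morphism_on_def)

text \<open>
  The exceptional closed set in the definition of a morphism can be enlarged to the zero set of a
  single form \<open>C\<close>. Multiplying by \<open>C\<close> then turns local identities into identities of forms on all
  of \<open>X\<close>.
\<close>

lemma morphism_onD:
  assumes "morphism_on X Y f" "p \<in> X" "v \<in> homog_coords p"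
  shows "\<exists>e C d F. form e C \<and> C v \<noteq> 0 \<and> (\<forall>j. form d (F j)) \<and>
    (\<forall>q\<in>X. \<forall>w\<in>homog_coords q. C w \<noteq> 0 \<longrightarrow> (\<chi> j. F j w) \<in> homog_coords (f q))"
proof -
  obtain Z d F where Z: "zariski_closed Z" "p \<notin> Z" "\<forall>j. form d (F j)"
    "\<forall>q\<in>X - Z. \<forall>w\<in>homog_coords q. (\<chi> j. F j w) \<in> homog_coords (f q)"
    using assms(1,2) unfolding morphism_on_def by blast
  obtain e C where "form e C" "C v \<noteq> 0" "\<forall>q\<in>Z. \<forall>w\<in>homog_coords q. C w = 0"
    using zariski_closed_separation[OF Z(1,2) assms(3)] by blast
  with Z show ?thesis by (intro exI[of _ e] exI[of _ C] exI[of _ d] exI[of _ F]) blast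
qed

lemma morphism_onI:
  assumes "f ` X \<subseteq> Y"
    and "\<And>p v. p \<in> X \<Longrightarrow> v \<in> homog_coords p \<Longrightarrow>
      \<exists>e C d F. form e C \<and> C v \<noteq> 0 \<and> (\<forall>j. form d (F j)) \<and>
        (\<forall>q\<in>X. \<forall>w\<in>homog_coords q. C w \<noteq> 0 \<longrightarrow> (\<chi> j. F j w) \<in> homog_coords (f q))"
  shows "morphism_on X Y f"
  unfolding morphism_on_def
proof (intro conjI ballI assms(1))
  fix p assume p: "p \<in> X"
  obtain v where v: "v \<in> homog_coords p" using homog_coords_exists by blast
  obtain e C d F where *: "form e C" "C v \<noteq> 0" "\<forall>j. form d (F j)"
    "\<forall>q\<in>X. \<forall>w\<in>homog_coords q. C w \<noteq> 0 \<longrightarrow> (\<chi> j. F j w) \<in> homog_coords (f q)"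
    using assms(2)[OF p v] by blast
  have "zariski_closed {q. vanishes_at C q}"
    unfolding zariski_closed_def using *(1) by (intro exI[of _ "{C}"]) auto
  moreover have "p \<notin> {q. vanishes_at C q}" using v *(2) by (auto simp: vanishes_at_def)
  moreover have "(\<chi> j. F j w) \<in> homog_coords (f q)"
    if "q \<in> X - {q. vanishes_at C q}" "w \<in> homog_coords q" for q w
    using that * vanishes_at_iff[OF *(1) that(2)] by simp
  ultimately show "\<exists>Z d F. zariski_closed Z \<and> p \<notin> Z \<and> (\<forall>j. form d (F j)) \<and>
      (\<forall>q\<in>X - Z. \<forall>v\<in>homog_coords q. (\<chi> j. F j v) \<in> homog_coords (f q))"
    using *(3) by blast
qed

lemma morphism_on_cong:
  assumes "morphism_on X Y f" "\<And>x. x \<in> X \<Longrightarrow> f x = g x" shows "morphism_on X Y g"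
proof (rule morphism_onI)
  show "g ` X \<subseteq> Y" using assms by (auto simp: morphism_on_def)
  fix p v assume "p \<in> X" "v \<in> homog_coords p"
  from morphism_onD[OF assms(1) this] obtain e C d F where F: "form e C" "C v \<noteq> 0" "\<forall>j. form d (F j)"
    "\<forall>q\<in>X. \<forall>w\<in>homog_coords q. C w \<noteq> 0 \<longrightarrow> (\<chi> j. F j w) \<in> homog_coords (f q)" by blast
  have "\<forall>q\<in>X. \<forall>w\<in>homog_coords q. C w \<noteq> 0 \<longrightarrow> (\<chi> j. F j w) \<in> homog_coords (g q)"
  proof
    fix q assume q: "q \<in> X"
    from F(4) this show "\<forall>w\<in>homog_coords q. C w \<noteq> 0 \<longrightarrow> (\<chi> j. F j w) \<in> homog_coords (g q)"
      unfolding assms(2)[OF q, symmetric] by blast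
  qed
  with F(1-3) show "\<exists>e C d F. form e C \<and> C v \<noteq> 0 \<and> (\<forall>j. form d (F j)) \<and>
        (\<forall>q\<in>X. \<forall>w\<in>homog_coords q. C w \<noteq> 0 \<longrightarrow> (\<chi> j. F j w) \<in> homog_coords (g q))"
    by blast
qed

lemma morphism_on_restrict:
  assumes "morphism_on X Y f" "X' \<subseteq> X" "f ` X' \<subseteq> Y'" shows "morphism_on X' Y' f"
proof (rule morphism_onI)
  fix p v assume p: "p \<in> X'" "v \<in> homog_coords p"
  then show "\<exists>e C d F. form e C \<and> C v \<noteq> 0 \<and> (\<forall>j. form d (F j)) \<and>
      (\<forall>q\<in>X'. \<forall>w\<in>homog_coords q. C w \<noteq> 0 \<longrightarrow> (\<chi> j. F j w) \<in> homog_coords (f q))"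
    using morphism_onD[OF assms(1), of p v] assms(2) by (meson subsetD)
qed (rule assms)

lemma morphism_on_compose:
  assumes f: "morphism_on X Y f" and g: "morphism_on Y Z g"
  shows "morphism_on X Z (g \<circ> f)"
proof (rule morphism_onI)
  show "(g \<circ> f) ` X \<subseteq> Z" using f g by (auto intro: morphism_on_apply)
  fix p v assume p: "p \<in> X" "v \<in> homog_coords p"
  obtain e C d F where F: "form e C" "C v \<noteq> 0" "\<And>j. form d (F j)"
    "\<And>q w. q \<in> X \<Longrightarrow> w \<in> homog_coords q \<Longrightarrow> C w \<noteq> 0 \<Longrightarrow> (\<chi> j. F j w) \<in> homog_coords (f q)"
    using morphism_onD[OF f p] by blast
  have fp: "f p \<in> Y" "(\<chi> j. F j v) \<in> homog_coords (f p)"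
    using morphism_on_apply[OF f] p F(2,4) by auto
  obtain e' C' d' F' where F': "form e' C'" "C' (\<chi> j. F j v) \<noteq> 0" "\<And>j. form d' (F' j)"
    "\<And>q w. q \<in> Y \<Longrightarrow> w \<in> homog_coords q \<Longrightarrow> C' w \<noteq> 0 \<Longrightarrow> (\<chi> j. F' j w) \<in> homog_coords (g q)"
    using morphism_onD[OF g fp] by blast
  show "\<exists>e C d F. form e C \<and> C v \<noteq> 0 \<and> (\<forall>j. form d (F j)) \<and>
      (\<forall>q\<in>X. \<forall>w\<in>homog_coords q. C w \<noteq> 0 \<longrightarrow> (\<chi> j. F j w) \<in> homog_coords ((g \<circ> f) q))"
  proof (intro exI conjI allI)
    show "form (e + d * e') (\<lambda>x. C x * C' (\<chi> j. F j x))"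
      by (rule form_mult[OF F(1) form_compose[OF F'(1) F(3)]])
    show "C v * C' (\<chi> j. F j v) \<noteq> 0" using F(2) F'(2) by simp
    show "form (d * d') (\<lambda>x. F' j (\<chi> j. F j x))" for j by (rule form_compose[OF F'(3) F(3)])
    show "\<forall>q\<in>X. \<forall>w\<in>homog_coords q. C w * C' (\<chi> j. F j w) \<noteq> 0 \<longrightarrow>
        (\<chi> k. F' k (\<chi> j. F j w)) \<in> homog_coords ((g \<circ> f) q)"
      using F(4) F'(4) morphism_on_apply[OF f] by auto
  qed
qed

lemma zariski_closed_preimage:
  assumes X: "zariski_closed X" and f: "morphism_on X Y f" and D: "zariski_closed D"
  shows "zariski_closed {x \<in> X. f x \<in> D}"
proof (rule zariski_closedI)
  fix p v assume p: "p \<notin> {x \<in> X. f x \<in> D}" and v: "v \<in> homog_coords p"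
  show "\<exists>d F. form d F \<and> F v \<noteq> 0 \<and> (\<forall>q\<in>{x \<in> X. f x \<in> D}. \<forall>w\<in>homog_coords q. F w = 0)"
  proof (cases "p \<in> X")
    case False
    then show ?thesis using zariski_closed_separation[OF X False v] by blast
  next
    case True
    obtain e C d F where F: "form e C" "C v \<noteq> 0" "\<And>j. form d (F j)"
      "\<And>q w. q \<in> X \<Longrightarrow> w \<in> homog_coords q \<Longrightarrow> C w \<noteq> 0 \<Longrightarrow> (\<chi> j. F j w) \<in> homog_coords (f q)"
      using morphism_onD[OF f True v] by blast
    have "f p \<notin> D" using p True by simp
    then obtain d' Q where Q: "form d' Q" "Q (\<chi> j. F j v) \<noteq> 0"
      "\<And>q w. q \<in> D \<Longrightarrow> w \<in> homog_coords q \<Longrightarrow> Q w = 0"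
      using zariski_closed_separation[OF D _ F(4)[OF True v F(2)]] by blast
    show ?thesis
    proof (intro exI conjI)
      show "form (e + d * d') (\<lambda>x. C x * Q (\<chi> j. F j x))"
        by (rule form_mult[OF F(1) form_compose[OF Q(1) F(3)]])
      show "C v * Q (\<chi> j. F j v) \<noteq> 0" using F(2) Q(2) by simp
      show "\<forall>q\<in>{x \<in> X. f x \<in> D}. \<forall>w\<in>homog_coords q. C w * Q (\<chi> j. F j w) = 0"
        using F(4) Q(3) by fastforce
    qed
  qed
qed

lemma proportional_if_minors_zero:
  fixes u w :: "complex^('n::finite)"
  assumes "u \<noteq> 0" "\<And>i j. u $ i * w $ j = u $ j * w $ i"
  shows "\<exists>a. w = a *s u"
proof -
  obtain i where i: "u $ i \<noteq> 0" using assms(1) by (auto simp: vec_eq_iff)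
  have "w $ j = w $ i / u $ i * u $ j" for j using assms(2)[of i j] i by (simp add: field_simps)
  then have "w = (w $ i / u $ i) *s u" unfolding vec_eq_iff vector_smult_component by blast
  then show ?thesis by blast
qed

text \<open>
  The graph of a morphism is cut out by bihomogeneous forms: near a point where the morphism is
  given by forms \<open>F\<close> outside the zeros of \<open>C\<close>, the functions \<open>C x * (F i x * y $ j - F j x * y $ i)\<close>
  vanish on the graph and separate it from the other points above. The image is the projection
  of the graph.
\<close>

theorem zariski_closed_image:
  fixes X :: "('n::finite) cproj set" and Y :: "('m::finite) cproj set"
  assumes X: "zariski_closed X" and f: "morphism_on X Y f"
  shows "zariski_closed (f ` X)"
proof (rule zariski_closedI)
  fix y w\<^sub>0 assume y: "y \<notin> f ` X" and w\<^sub>0: "w\<^sub>0 \<in> homog_coords y"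
  \<comment> \<open>All bihomogeneous forms, as forms in \<open>x\<close> with forms in \<open>y\<close> as coefficients, that vanish on the graph.\<close>
  define B :: "(nat \<times> (('n \<Rightarrow> nat) \<Rightarrow> complex^'m \<Rightarrow> complex)) set" where
    "B = {(d, b). (\<exists>e. \<forall>\<alpha>. form e (b \<alpha>)) \<and>
      (\<forall>x\<in>X. \<forall>v\<in>homog_coords x. \<forall>w\<in>homog_coords (f x). form_of d (\<lambda>\<alpha>. b \<alpha> w) v = 0)}"
  have "\<exists>(d, b)\<in>B. form_of d (\<lambda>\<alpha>. b \<alpha> w\<^sub>0) v \<noteq> 0" if v0: "v \<noteq> 0" for v
  proof (cases "point_of v \<in> X")
    case False
    obtain d F where F: "form d F" "F v \<noteq> 0" "\<forall>q\<in>X. \<forall>w\<in>homog_coords q. F w = 0"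
      using zariski_closed_separation[OF X False homog_coords_point_of[OF v0]] by blast
    then obtain c where c: "F = form_of d c" by (auto simp: form_iff)
    have "(d, \<lambda>\<alpha> _. c \<alpha>) \<in> B" using F c by (auto simp: B_def intro: form_const)
    then show ?thesis using F(2) c by (intro bexI[of _ "(d, \<lambda>\<alpha> _. c \<alpha>)"]) auto
  next
    case True
    let ?p = "point_of v"
    note v = homog_coords_point_of[OF v0]
    obtain e C d F where F: "form e C" "C v \<noteq> 0" "\<And>j. form d (F j)"
      "\<And>q w. q \<in> X \<Longrightarrow> w \<in> homog_coords q \<Longrightarrow> C w \<noteq> 0 \<Longrightarrow> (\<chi> j. F j w) \<in> homog_coords (f q)"
      using morphism_onD[OF f True v] by blast
    have u: "(\<chi> j. F j v) \<in> homog_coords (f ?p)" by (rule F(4)[OF True v F(2)])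
    have "\<exists>i j. F i v * w\<^sub>0 $ j \<noteq> F j v * w\<^sub>0 $ i"
    proof (rule ccontr)
      assume "\<not> ?thesis"
      then obtain a where a: "w\<^sub>0 = a *s (\<chi> j. F j v)"
        using proportional_if_minors_zero[OF homog_coords_nonzero[OF u], of w\<^sub>0] by auto
      moreover have "a \<noteq> 0" using a homog_coords_nonzero[OF w\<^sub>0] by auto
      ultimately have "w\<^sub>0 \<in> homog_coords (f ?p)" using homog_coords_scale_iff[OF u] by blast
      then show False using homog_coords_unique[OF w\<^sub>0] y True by blast
    qed
    then obtain i j where ij: "F i v * w\<^sub>0 $ j \<noteq> F j v * w\<^sub>0 $ i" by blast
    have "\<exists>c. \<forall>k x. C x * F k x = form_of (e + d) (c k) x"
      using form_mult[OF F(1,3)] unfolding form_iff by metis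
    then obtain c where c: "\<And>k x. form_of (e + d) (c k) x = C x * F k x" by metis
    define b where "b \<alpha> w = c i \<alpha> * w $ j - c j \<alpha> * w $ i" for \<alpha> and w :: "complex^'m"
    have b: "form_of (e + d) (\<lambda>\<alpha>. b \<alpha> w) x = C x * (F i x * w $ j - F j x * w $ i)" for x w
    proof -
      have "form_of (e + d) (\<lambda>\<alpha>. b \<alpha> w) x
          = form_of (e + d) (c i) x * w $ j - form_of (e + d) (c j) x * w $ i"
        unfolding form_of_def b_def sum_distrib_right sum_subtractf[symmetric]
        by (intro sum.cong) (simp_all add: algebra_simps)
      then show ?thesis by (simp add: c right_diff_distrib)
    qed
    have "(e + d, b) \<in> B"
    proof -
      have "form 1 (b \<alpha>)" for \<alpha>
        unfolding b_def by (rule form_diff[OF form_cmult[OF form_coordinate] form_cmult[OF form_coordinate]])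
      moreover have "C x * (F i x * w $ j - F j x * w $ i) = 0"
        if q: "q \<in> X" "x \<in> homog_coords q" and w: "w \<in> homog_coords (f q)" for q x w
      proof (cases "C x = 0")
        case False
        then obtain a where "w = a *s (\<chi> j. F j x)"
          using F(4)[OF q False] homog_coords_scale_iff w by blast
        then show ?thesis by simp
      qed simp
      ultimately show ?thesis unfolding B_def by (auto simp: b)
    qed
    moreover have "form_of (e + d) (\<lambda>\<alpha>. b \<alpha> w\<^sub>0) v \<noteq> 0" using F(2) ij by (simp add: b)
    ultimately show ?thesis by blast
  qed
  moreover have "\<exists>e. \<forall>\<alpha>. form e (b \<alpha>)" if "(d, b) \<in> B" for d b using that by (simp add: B_def)
  ultimately obtain e P where P: "form e P" "P w\<^sub>0 \<noteq> 0"
    "\<And>w v. P w \<noteq> 0 \<Longrightarrow> v \<noteq> 0 \<Longrightarrow> \<exists>(d, b)\<in>B. form_of d (\<lambda>\<alpha>. b \<alpha> w) v \<noteq> 0"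
    using no_common_zero_open[of B w\<^sub>0] by blast
  have "P w = 0" if "x \<in> X" "w \<in> homog_coords (f x)" for x w
  proof (rule ccontr)
    assume "P w \<noteq> 0"
    moreover obtain v where v: "v \<in> homog_coords x" using homog_coords_exists by blast
    ultimately have "\<exists>(d, b)\<in>B. form_of d (\<lambda>\<alpha>. b \<alpha> w) v \<noteq> 0"
      using P(3) homog_coords_nonzero by blast
    then show False using that v unfolding B_def by blast
  qed
  with P show "\<exists>d F. form d F \<and> F w\<^sub>0 \<noteq> 0 \<and> (\<forall>q\<in>f ` X. \<forall>w\<in>homog_coords q. F w = 0)" by blast
qed

lemma homog_coords_segreD:
  assumes "z \<in> homog_coords (segre (p, q))" "v \<in> homog_coords p" "w \<in> homog_coords q"
  shows "\<exists>a. z = a *s tensor v w"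
  using assms(1) unfolding homog_coords_scale_iff[OF tensor_in_segre[OF assms(2,3)]] by blast

text \<open>
  A tensor all of whose \<open>2 \<times> 2\<close> minors vanish is pure, and its factors are proportional to any
  nonzero column and row; so the equations of the factors can be imposed on the columns and rows.
\<close>

lemma zariski_closed_segre:
  fixes S :: "('n::finite) cproj set" and T :: "('m::finite) cproj set"
  assumes S: "zariski_closed S" and T: "zariski_closed T"
  shows "zariski_closed (segre ` (S \<times> T))"
proof (rule zariski_closedI)
  fix r and z :: "complex^('n \<times> 'm)"
  assume r: "r \<notin> segre ` (S \<times> T)" and z: "z \<in> homog_coords r"
  let ?goal = "\<exists>d F. form d F \<and> F z \<noteq> 0 \<and> (\<forall>q\<in>segre ` (S \<times> T). \<forall>w\<in>homog_coords q. F w = 0)"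
  have pure: "\<exists>p q v w a. p \<in> S \<and> q \<in> T \<and> v \<in> homog_coords p \<and> w \<in> homog_coords q \<and> x = a *s tensor v w"
    if t: "t \<in> segre ` (S \<times> T)" and x: "x \<in> homog_coords t" for t x
  proof -
    obtain p q where pq: "t = segre (p, q)" "p \<in> S" "q \<in> T" using t by (elim imageE SigmaE) simp
    obtain v where v: "v \<in> homog_coords p" using homog_coords_exists by blast
    obtain w where w: "w \<in> homog_coords q" using homog_coords_exists by blast
    obtain a where "x = a *s tensor v w" using homog_coords_segreD[OF _ v w] x pq(1) by blast
    then show ?thesis using pq(2,3) v w by (intro exI conjI)
  qed
  show ?goal
  proof (cases "\<forall>i j k l. z $ (i, j) * z $ (k, l) = z $ (i, l) * z $ (k, j)")
    case False
    then obtain i j k l where ijkl: "z $ (i, j) * z $ (k, l) \<noteq> z $ (i, l) * z $ (k, j)" by blast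
    define F :: "complex^('n \<times> 'm) \<Rightarrow> complex" where
      "F = (\<lambda>x. x $ (i, j) * x $ (k, l) - x $ (i, l) * x $ (k, j))"
    have "form (1 + 1) F" unfolding F_def
      by (rule form_diff[OF form_mult[OF form_coordinate form_coordinate] form_mult[OF form_coordinate form_coordinate]])
    moreover have "F z \<noteq> 0" using ijkl by (simp add: F_def)
    moreover have "F x = 0" if "t \<in> segre ` (S \<times> T)" "x \<in> homog_coords t" for t x
    proof -
      obtain v w a where "x = a *s tensor v w"
        using pure[OF \<open>t \<in> segre ` (S \<times> T)\<close> \<open>x \<in> homog_coords t\<close>] by blast
      then show ?thesis by (simp add: F_def tensor_def)
    qed
    ultimately show ?thesis by blast
  next
    case True
    obtain i j where ij: "z $ (i, j) \<noteq> 0"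
      using homog_coords_nonzero[OF z] by (auto simp: vec_eq_iff)
    define v where "v = (\<chi> k. z $ (k, j))"
    define w where "w = (\<chi> l. z $ (i, l))"
    have "v \<noteq> 0" using ij unfolding v_def vec_eq_iff by auto
    note v = homog_coords_point_of[OF this]
    have "w \<noteq> 0" using ij unfolding w_def vec_eq_iff by auto
    note w = homog_coords_point_of[OF this]
    have "tensor v w = z $ (i, j) *s z"
      using True by (auto simp: tensor_def v_def w_def vec_eq_iff mult.commute)
    then have "tensor v w \<in> homog_coords r" using homog_coords_scale_iff[OF z] ij by blast
    then have "r = segre (point_of v, point_of w)" using tensor_in_segre[OF v w] homog_coords_unique by blast
    then consider "point_of v \<notin> S" | "point_of w \<notin> T" using r by blast
    then show ?thesis
    proof cases
      case 1
      then obtain d F where F: "form d F" "F v \<noteq> 0" "\<forall>q\<in>S. \<forall>w\<in>homog_coords q. F w = 0"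
        using zariski_closed_separation[OF S _ v] by blast
      have "form (1 * d) (\<lambda>x. F (\<chi> k. x $ (k, j)))" by (rule form_compose[OF F(1) form_coordinate])
      moreover have "F (\<chi> k. x $ (k, j)) = 0" if "t \<in> segre ` (S \<times> T)" "x \<in> homog_coords t" for t x
      proof -
        obtain p v' w' a where "p \<in> S" "v' \<in> homog_coords p" and x: "x = a *s tensor v' w'"
          using pure[OF \<open>t \<in> segre ` (S \<times> T)\<close> \<open>x \<in> homog_coords t\<close>] by blast
        moreover have "(\<chi> k. x $ (k, j)) = (a * w' $ j) *s v'"
          by (simp add: x tensor_def vec_eq_iff)
        ultimately show ?thesis using F(3) by (simp add: form_homogeneous[OF F(1)])
      qed
      ultimately show ?thesis using F(2) unfolding v_def by blast
    next
      case 2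
      then obtain d F where F: "form d F" "F w \<noteq> 0" "\<forall>q\<in>T. \<forall>w\<in>homog_coords q. F w = 0"
        using zariski_closed_separation[OF T _ w] by blast
      have "form (1 * d) (\<lambda>x. F (\<chi> l. x $ (i, l)))" by (rule form_compose[OF F(1) form_coordinate])
      moreover have "F (\<chi> l. x $ (i, l)) = 0" if "t \<in> segre ` (S \<times> T)" "x \<in> homog_coords t" for t x
      proof -
        obtain q v' w' a where "q \<in> T" "w' \<in> homog_coords q" and x: "x = a *s tensor v' w'"
          using pure[OF \<open>t \<in> segre ` (S \<times> T)\<close> \<open>x \<in> homog_coords t\<close>] by blast
        moreover have "(\<chi> l. x $ (i, l)) = (a * v' $ i) *s w'"
          by (simp add: x tensor_def vec_eq_iff mult_ac)
        ultimately show ?thesis using F(3) by (simp add: form_homogeneous[OF F(1)])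
      qed
      ultimately show ?thesis using F(2) unfolding w_def by blast
    qed
  qed
qed

lemma morphism_on_segre_left:
  assumes "p \<in> X" shows "morphism_on Y (segre ` (X \<times> Y)) (\<lambda>q. segre (p, q))"
proof (rule morphism_onI)
  obtain v where v: "v \<in> homog_coords p" using homog_coords_exists by blast
  fix q\<^sub>0 w\<^sub>0
  show "\<exists>e C d F. form e C \<and> C w\<^sub>0 \<noteq> 0 \<and> (\<forall>k. form d (F k)) \<and>
      (\<forall>q\<in>Y. \<forall>w\<in>homog_coords q. C w \<noteq> 0 \<longrightarrow> (\<chi> k. F k w) \<in> homog_coords (segre (p, q)))"
  proof (rule exI[of _ 0], rule exI[of _ "\<lambda>_. 1"], rule exI[of _ 1],
      rule exI[of _ "\<lambda>k w. v $ fst k * w $ snd k"], intro conjI allI)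
    show "form 0 (\<lambda>_. 1)" by (rule form_const)
    show "form 1 (\<lambda>w. v $ fst k * w $ snd k)" for k by (rule form_cmult[OF form_coordinate])
  qed (use tensor_in_segre[OF v] in \<open>auto simp: tensor_def\<close>)
qed (use assms in auto)

lemma morphism_on_segre_right:
  assumes "q \<in> Y" shows "morphism_on X (segre ` (X \<times> Y)) (\<lambda>p. segre (p, q))"
proof (rule morphism_onI)
  obtain w where w: "w \<in> homog_coords q" using homog_coords_exists by blast
  fix p\<^sub>0 v\<^sub>0
  show "\<exists>e C d F. form e C \<and> C v\<^sub>0 \<noteq> 0 \<and> (\<forall>k. form d (F k)) \<and>
      (\<forall>p\<in>X. \<forall>v\<in>homog_coords p. C v \<noteq> 0 \<longrightarrow> (\<chi> k. F k v) \<in> homog_coords (segre (p, q)))"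
  proof (rule exI[of _ 0], rule exI[of _ "\<lambda>_. 1"], rule exI[of _ 1],
      rule exI[of _ "\<lambda>k v. v $ fst k * w $ snd k"], intro conjI allI)
    show "form 0 (\<lambda>_. 1)" by (rule form_const)
    show "form 1 (\<lambda>v. v $ fst k * w $ snd k)" for k
      using form_cmult[OF form_coordinate[of "fst k"], of "w $ snd k"] by (simp add: mult.commute)
  qed (use tensor_in_segre[OF _ w] in \<open>auto simp: tensor_def\<close>)
qed (use assms in auto)

lemma zariski_irreducible_image:
  assumes X: "zariski_closed X" "zariski_irreducible X" and f: "morphism_on X Y f"
  shows "zariski_irreducible (f ` X)"
  unfolding zariski_irreducible_def
proof (intro conjI allI impI)
  show "f ` X \<noteq> {}" using X by (simp add: zariski_irreducible_def)
  fix A B assume AB: "zariski_closed A \<and> zariski_closed B \<and> f ` X \<subseteq> A \<union> B"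
  then have "zariski_closed {x \<in> X. f x \<in> A}" "zariski_closed {x \<in> X. f x \<in> B}"
    using zariski_closed_preimage[OF X(1) f] by auto
  moreover have "X \<subseteq> {x \<in> X. f x \<in> A} \<union> {x \<in> X. f x \<in> B}" using AB by auto
  ultimately have "X \<subseteq> {x \<in> X. f x \<in> A} \<or> X \<subseteq> {x \<in> X. f x \<in> B}"
    using X(2) unfolding zariski_irreducible_def by blast
  then show "f ` X \<subseteq> A \<or> f ` X \<subseteq> B" by auto
qed

section \<open>Chains of irreducible closed sets\<close>

definition zero_on :: "('n::finite) cproj set \<Rightarrow> (complex^'n \<Rightarrow> complex) \<Rightarrow> bool" where
  "zero_on Z F \<longleftrightarrow> (\<forall>p\<in>Z. \<forall>v\<in>homog_coords p. F v = 0)"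

definition independent_on ::
  "('n::finite) cproj set \<Rightarrow> 'i set \<Rightarrow> ('i \<Rightarrow> complex^'n \<Rightarrow> complex) \<Rightarrow> bool" where
  "independent_on Z I G \<longleftrightarrow>
     (\<forall>c. zero_on Z (\<lambda>x. \<Sum>a\<in>I. c a * G a x) \<longrightarrow> (\<forall>a\<in>I. c a = 0))"

lemma independent_onD:
  "independent_on Z I G \<Longrightarrow> zero_on Z (\<lambda>x. \<Sum>a\<in>I. c a * G a x) \<Longrightarrow> \<forall>a\<in>I. c a = 0"
  unfolding independent_on_def by simp

lemma zariski_irreducible_cancel:
  assumes Z: "zariski_irreducible Z" and F: "form d F" and G: "form e G"
    and FG: "zero_on Z (\<lambda>x. F x * G x)" and nz: "\<not> zero_on Z F"
  shows "zero_on Z G"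
proof -
  have closed: "zariski_closed {p. vanishes_at H p}" if "form d H" for d H
    unfolding zariski_closed_def using that by (intro exI[of _ "{H}"]) auto
  have "Z \<subseteq> {p. vanishes_at F p} \<union> {p. vanishes_at G p}"
  proof
    fix p assume p: "p \<in> Z"
    obtain v where v: "v \<in> homog_coords p" using homog_coords_exists by blast
    have "F v * G v = 0" using FG p v by (simp add: zero_on_def)
    then show "p \<in> {p. vanishes_at F p} \<union> {p. vanishes_at G p}"
      using vanishes_at_iff[OF F v] vanishes_at_iff[OF G v] by auto
  qed
  then have "Z \<subseteq> {p. vanishes_at F p} \<or> Z \<subseteq> {p. vanishes_at G p}"
    using Z closed[OF F] closed[OF G] unfolding zariski_irreducible_def by blast
  then show ?thesis using nz unfolding zero_on_def vanishes_at_def by blast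
qed

lemma not_zero_on_power: "\<not> zero_on Z F \<Longrightarrow> \<not> zero_on Z (\<lambda>x. F x ^ j)"
  by (auto simp: zero_on_def)

text \<open>
  Passing from an irreducible closed set \<open>Z'\<close> to a larger one \<open>Z\<close> multiplies the number of
  independent forms by \<open>m + 1\<close> while raising the degree only linearly in \<open>m\<close>. In a relation on
  \<open>Z\<close> the lowest power of \<open>F\<close> can be cancelled; restricting to \<open>Z'\<close>, where \<open>F\<close> vanishes, then
  isolates the coefficients of that power.
\<close>

lemma independent_on_extend:
  assumes Z: "zariski_irreducible Z" and Z': "zariski_irreducible Z'" "Z' \<subseteq> Z"
    and F: "form d F" "zero_on Z' F" "\<not> zero_on Z F"
    and L: "form d L" "\<not> zero_on Z' L"
    and G: "\<And>a. a \<in> I \<Longrightarrow> form e (G a)" "independent_on Z' I G" and I: "finite I"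
  shows "independent_on Z ({..m} \<times> I) (\<lambda>(j, a) x. G a x * F x ^ j * L x ^ (m - j))"
  unfolding independent_on_def
proof (intro allI impI)
  fix c :: "nat \<times> _ \<Rightarrow> complex"
  assume rel: "zero_on Z (\<lambda>x. \<Sum>k\<in>{..m} \<times> I. c k * (case k of (j, a) \<Rightarrow> \<lambda>x. G a x * F x ^ j * L x ^ (m - j)) x)"
  define S where "S j x = (\<Sum>a\<in>I. c (j, a) * G a x)" for j x
  have S: "form e (S j)" for j unfolding S_def by (intro form_sum form_cmult G)
  have rel': "zero_on Z (\<lambda>x. \<Sum>j\<le>m. F x ^ j * L x ^ (m - j) * S j x)"
  proof -
    have "(\<Sum>k\<in>{..m} \<times> I. c k * (case k of (j, a) \<Rightarrow> \<lambda>x. G a x * F x ^ j * L x ^ (m - j)) x)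
        = (\<Sum>j\<le>m. F x ^ j * L x ^ (m - j) * S j x)" for x
      by (simp add: sum.cartesian_product' S_def sum_distrib_left mult_ac)
    with rel show ?thesis by simp
  qed
  have "\<forall>a\<in>I. c (j, a) = 0" if "j \<le> m" for j
    using that
  proof (induction j rule: less_induct)
    case (less j)
    have S0: "S i x = 0" if "i < j" for i x
      using less.IH[OF that] less.prems that by (simp add: S_def)
    define T where "T x = (\<Sum>i\<in>{j..m}. F x ^ (i - j) * L x ^ (m - i) * S i x)" for x
    have FT: "F x ^ j * T x = (\<Sum>i\<le>m. F x ^ i * L x ^ (m - i) * S i x)" for x
    proof -
      have "(\<Sum>i\<le>m. F x ^ i * L x ^ (m - i) * S i x) = (\<Sum>i\<in>{j..m}. F x ^ i * L x ^ (m - i) * S i x)"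
        by (rule sum.mono_neutral_right) (auto simp: S0 not_le)
      also have "\<dots> = (\<Sum>i\<in>{j..m}. F x ^ j * (F x ^ (i - j) * L x ^ (m - i) * S i x))"
        by (intro sum.cong refl) (auto simp flip: mult.assoc power_add)
      finally show ?thesis by (simp add: T_def sum_distrib_left)
    qed
    have T: "form (d * (m - j) + e) T"
      unfolding T_def
    proof (rule form_sum)
      fix i assume i: "i \<in> {j..m}"
      have "form (d * (i - j) + d * (m - i) + e) (\<lambda>x. F x ^ (i - j) * L x ^ (m - i) * S i x)"
        by (rule form_mult[OF form_mult[OF form_power[OF F(1)] form_power[OF L(1)]] S])
      moreover have "d * (i - j) + d * (m - i) = d * (m - j)"
        using i by (simp flip: distrib_left)
      ultimately show "form (d * (m - j) + e) (\<lambda>x. F x ^ (i - j) * L x ^ (m - i) * S i x)" by simp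
    qed
    have "zero_on Z (\<lambda>x. F x ^ j * T x)" using rel' by (simp add: FT)
    from zariski_irreducible_cancel[OF Z form_power[OF F(1)] T this not_zero_on_power[OF F(3)]]
    have "zero_on Z' T" using Z'(2) unfolding zero_on_def by blast
    moreover have "T x = L x ^ (m - j) * S j x" if "F x = 0" for x
    proof -
      have "T x = (\<Sum>i\<in>{j..m}. if i = j then L x ^ (m - j) * S j x else 0)"
        unfolding T_def by (intro sum.cong) (auto simp: that)
      then show ?thesis using less.prems by simp
    qed
    ultimately have "zero_on Z' (\<lambda>x. L x ^ (m - j) * S j x)"
      using F(2) unfolding zero_on_def by metis
    from zariski_irreducible_cancel[OF Z'(1) form_power[OF L(1)] S this not_zero_on_power[OF L(2)]]
    have "zero_on Z' (\<lambda>x. \<Sum>a\<in>I. c (j, a) * G a x)" by (simp add: S_def[abs_def])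
    from independent_onD[OF G(2) this] show ?case .
  qed
  then show "\<forall>k\<in>{..m} \<times> I. c k = 0" by auto
qed

lemma independent_on_reindex:
  assumes "inj_on h I" "independent_on Z I (\<lambda>a. G (h a))" shows "independent_on Z (h ` I) G"
  unfolding independent_on_def
proof (intro allI impI)
  fix c assume "zero_on Z (\<lambda>x. \<Sum>a\<in>h ` I. c a * G a x)"
  then have "zero_on Z (\<lambda>x. \<Sum>a\<in>I. c (h a) * G (h a) x)" by (simp add: sum.reindex[OF assms(1)])
  from independent_onD[OF assms(2) this] have "\<forall>a\<in>I. c (h a) = 0" .
  then show "\<forall>a\<in>h ` I. c a = 0" by simp
qed

text \<open>
  A chain of length \<open>k\<close> thus supports \<open>(m + 1) ^ k\<close> independent forms whose degree grows only
  linearly in \<open>m\<close>. The index list of a form records the exponents chosen along the chain.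
\<close>

lemma independent_forms_on_chain:
  fixes Z :: "nat \<Rightarrow> ('n::finite) cproj set"
  assumes "\<And>i. i \<le> k \<Longrightarrow> zariski_closed (Z i) \<and> zariski_irreducible (Z i)"
    and "\<And>i. i < k \<Longrightarrow> Z i \<subset> Z (Suc i)"
  shows "\<exists>D. \<forall>m. \<exists>(I :: nat list set) G. finite I \<and> card I = (m + 1) ^ k \<and>
    (\<forall>a\<in>I. form (D * m) (G a)) \<and> independent_on (Z k) I G"
  using assms
proof (induction k)
  case 0
  then obtain p where p: "p \<in> Z 0" unfolding zariski_irreducible_def by blast
  obtain v where v: "v \<in> homog_coords p" using homog_coords_exists by blast
  have "independent_on (Z 0) {[] :: nat list} (\<lambda>_ _. 1)"
    unfolding independent_on_def zero_on_def using p v by auto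
  then show ?case
    by (intro exI[of _ 0] allI exI[of _ "{[] :: nat list}"] exI[of _ "\<lambda>_ _. 1"]) (simp add: form_const)
next
  case (Suc k)
  obtain D where D: "\<And>m. \<exists>(I :: nat list set) G. finite I \<and> card I = (m + 1) ^ k \<and>
    (\<forall>a\<in>I. form (D * m) (G a)) \<and> independent_on (Z k) I G"
    using Suc.IH Suc.prems by (metis le_SucI less_SucI)
  have Z: "zariski_closed (Z k)" "zariski_irreducible (Z k)" "zariski_irreducible (Z (Suc k))"
    "Z k \<subset> Z (Suc k)" using Suc.prems by auto
  then obtain p where p: "p \<in> Z (Suc k)" "p \<notin> Z k" by blast
  obtain v where v: "v \<in> homog_coords p" using homog_coords_exists by blast
  obtain d F where F: "form d F" "F v \<noteq> 0" "\<forall>q\<in>Z k. \<forall>w\<in>homog_coords q. F w = 0"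
    using zariski_closed_separation[OF Z(1) p(2) v] by blast
  have F0: "zero_on (Z k) F" "\<not> zero_on (Z (Suc k)) F" using F p v unfolding zero_on_def by blast+
  obtain q where q: "q \<in> Z k" using Z(2) unfolding zariski_irreducible_def by blast
  obtain w where w: "w \<in> homog_coords q" using homog_coords_exists by blast
  obtain i where i: "w $ i \<noteq> 0" using homog_coords_nonzero[OF w] by (auto simp: vec_eq_iff)
  \<comment> \<open>Powers of \<open>F\<close> are completed by powers of a form of the same degree that does not vanish on \<open>Z k\<close>.\<close>
  define L where "L x = x $ i ^ d" for x :: "complex^'n"
  have L: "form d L" using form_power[OF form_coordinate, of d i] by (simp add: L_def[abs_def])
  have L0: "\<not> zero_on (Z k) L" using q w i by (auto simp: zero_on_def L_def)
  show ?case
  proof (intro exI[of _ "D + d"] allI)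
    fix m
    obtain I :: "nat list set" and G where I: "finite I" "card I = (m + 1) ^ k"
      and G: "\<And>a. a \<in> I \<Longrightarrow> form (D * m) (G a)" "independent_on (Z k) I G" using D[of m] by blast
    define h where "h = (\<lambda>(j :: nat, a). j # a)"
    define H where "H l x = G (tl l) x * F x ^ hd l * L x ^ (m - hd l)" for l x
    have inj: "inj_on h ({..m} \<times> I)" by (auto simp: h_def inj_on_def)
    have "independent_on (Z (Suc k)) ({..m} \<times> I) (\<lambda>(j, a) x. G a x * F x ^ j * L x ^ (m - j))"
      by (rule independent_on_extend[OF Z(3,2) _ F(1) F0 L L0 G I(1)]) (use Z(4) in auto)
    moreover have "(\<lambda>(j, a) x. G a x * F x ^ j * L x ^ (m - j)) = (\<lambda>a. H (h a))"
      by (auto simp: H_def h_def fun_eq_iff)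
    ultimately have "independent_on (Z (Suc k)) (h ` ({..m} \<times> I)) H"
      using independent_on_reindex[OF inj] by metis
    moreover have "form ((D + d) * m) (H l)" if "l \<in> h ` ({..m} \<times> I)" for l
    proof -
      obtain j a where l: "l = j # a" "j \<le> m" "a \<in> I"
        using \<open>l \<in> h ` ({..m} \<times> I)\<close> by (auto simp: h_def)
      have "form (D * m + d * j + d * (m - j)) (\<lambda>x. G a x * F x ^ j * L x ^ (m - j))"
        by (rule form_mult[OF form_mult[OF G(1)[OF l(3)] form_power[OF F(1)]] form_power[OF L]])
      moreover have "d * j + d * (m - j) = d * m" using l(2) by (simp flip: distrib_left)
      then have "D * m + d * j + d * (m - j) = (D + d) * m" by (simp add: distrib_right)
      ultimately show ?thesis by (simp add: H_def[abs_def] l(1))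
    qed
    moreover have "card (h ` ({..m} \<times> I)) = (m + 1) ^ Suc k"
      by (simp add: card_image[OF inj] I card_cartesian_product)
    moreover have "finite (h ` ({..m} \<times> I))" using I by simp
    ultimately show "\<exists>(I :: nat list set) G. finite I \<and> card I = (m + 1) ^ Suc k \<and>
      (\<forall>a\<in>I. form ((D + d) * m) (G a)) \<and> independent_on (Z (Suc k)) I G" by blast
  qed
qed

lemma card_independent_forms_le:
  fixes Z :: "('n::finite) cproj set"
  assumes "finite I" "\<And>a. a \<in> I \<Longrightarrow> form e (G a)" "independent_on Z I G"
  shows "card I \<le> (e + 1) ^ CARD('n)"
proof -
  have "\<forall>a\<in>I. \<exists>c. G a = form_of e c" using assms(2) by (simp add: form_iff)
  then obtain M where M: "\<And>a. a \<in> I \<Longrightarrow> G a = form_of e (M a)" by metis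
  have "card I \<le> card (exponents e :: ('n \<Rightarrow> nat) set)"
  proof (rule ccontr)
    assume "\<not> ?thesis"
    then obtain c where c: "\<exists>a\<in>I. c a \<noteq> 0"
      "\<forall>\<alpha>\<in>exponents e. (\<Sum>a\<in>I. c a * M a \<alpha>) = 0"
      using dependent_if_card_less[OF finite_exponents' assms(1), of e M] by (auto simp: not_le)
    have "(\<Sum>a\<in>I. c a * G a x) = 0" for x
    proof -
      have "(\<Sum>a\<in>I. c a * G a x) = (\<Sum>a\<in>I. \<Sum>\<alpha>\<in>exponents e. c a * M a \<alpha> * power_product \<alpha> x)"
        by (intro sum.cong) (auto simp: M form_of_def sum_distrib_left mult.assoc)
      also have "\<dots> = (\<Sum>\<alpha>\<in>exponents e. (\<Sum>a\<in>I. c a * M a \<alpha>) * power_product \<alpha> x)"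
        by (subst sum.swap) (simp add: sum_distrib_right)
      finally show ?thesis using c(2) by simp
    qed
    then have "zero_on Z (\<lambda>x. \<Sum>a\<in>I. c a * G a x)" by (simp add: zero_on_def)
    from independent_onD[OF assms(3) this] c(1) show False by blast
  qed
  also have "\<dots> \<le> card (PiE (UNIV :: 'n set) (\<lambda>_. {..e}))"
    by (rule card_mono) (auto simp: finite_PiE exponents_def intro!: member_le_sum)
  also have "\<dots> = (e + 1) ^ CARD('n)" by (simp add: card_PiE)
  finally show ?thesis .
qed

text \<open>
  The number of independent forms of a given degree in \<open>n\<close> variables grows at most like the \<open>n\<close>-th
  power of the degree, so a chain of length \<open>n + 1\<close> is impossible.
\<close>

lemma no_infinite_chain_of_irreducibles:
  fixes Z :: "nat \<Rightarrow> ('n::finite) cproj set"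
  assumes "\<And>i. zariski_closed (Z i)" "\<And>i. zariski_irreducible (Z i)"
  shows "\<exists>i. \<not> Z i \<subset> Z (Suc i)"
proof (rule ccontr)
  assume "\<not> ?thesis"
  then obtain D where D: "\<And>m. \<exists>(I :: nat list set) G. finite I \<and> card I = (m + 1) ^ (CARD('n) + 1) \<and>
    (\<forall>a\<in>I. form (D * m) (G a)) \<and> independent_on (Z (CARD('n) + 1)) I G"
    using independent_forms_on_chain[of "CARD('n) + 1" Z] assms by blast
  \<comment> \<open>The counts force \<open>m + 1 \<le> (D + 1) ^ CARD('n)\<close>, so this choice is contradictory.\<close>
  define m where "m = (D + 1) ^ CARD('n)"
  have "(m + 1) * (m + 1) ^ CARD('n) \<le> (D * m + 1) ^ CARD('n)"
    using D[of m] card_independent_forms_le by fastforce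
  also have "\<dots> \<le> ((D + 1) * (m + 1)) ^ CARD('n)" by (intro power_mono) auto
  also have "\<dots> = m * (m + 1) ^ CARD('n)" by (simp only: power_mult_distrib m_def)
  finally show False by simp
qed

lemma maximal_irreducible_exists:
  assumes "\<P> \<noteq> {}" "\<And>P. P \<in> \<P> \<Longrightarrow> zariski_closed P \<and> zariski_irreducible P"
  shows "\<exists>P\<in>\<P>. \<forall>Q\<in>\<P>. P \<subseteq> Q \<longrightarrow> Q = P"
proof (rule ccontr)
  assume "\<not> ?thesis"
  then have "\<forall>P\<in>\<P>. \<exists>Q\<in>\<P>. P \<subset> Q" by blast
  then obtain next_set where step: "\<And>P. P \<in> \<P> \<Longrightarrow> next_set P \<in> \<P> \<and> P \<subset> next_set P" by metis
  obtain P\<^sub>0 where "P\<^sub>0 \<in> \<P>" using assms(1) by blast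
  then have "(next_set ^^ i) P\<^sub>0 \<in> \<P>" for i by (induction i) (auto simp: step)
  then show False
    using no_infinite_chain_of_irreducibles[of "\<lambda>i. (next_set ^^ i) P\<^sub>0"] assms(2) step by auto
qed

section \<open>Products in a projective algebraic group\<close>

lemma morphism_on_left_translation:
  assumes G: "projective_algebraic_group G" and a: "a \<in> carrier G"
  shows "morphism_on (carrier G) (carrier G) (\<lambda>x. a \<otimes>\<^bsub>G\<^esub> x)"
proof -
  obtain \<mu> where \<mu>: "morphism_on (segre ` (carrier G \<times> carrier G)) (carrier G) \<mu>"
    "\<And>x y. x \<in> carrier G \<Longrightarrow> y \<in> carrier G \<Longrightarrow> \<mu> (segre (x, y)) = x \<otimes>\<^bsub>G\<^esub> y"
    using G unfolding projective_algebraic_group_def morphism2_on_def by blast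
  from morphism_on_compose[OF morphism_on_segre_left[OF a] \<mu>(1)]
  show ?thesis by (rule morphism_on_cong) (simp add: \<mu>(2) a)
qed

lemma morphism_on_right_translation:
  assumes G: "projective_algebraic_group G" and a: "a \<in> carrier G"
  shows "morphism_on (carrier G) (carrier G) (\<lambda>x. x \<otimes>\<^bsub>G\<^esub> a)"
proof -
  obtain \<mu> where \<mu>: "morphism_on (segre ` (carrier G \<times> carrier G)) (carrier G) \<mu>"
    "\<And>x y. x \<in> carrier G \<Longrightarrow> y \<in> carrier G \<Longrightarrow> \<mu> (segre (x, y)) = x \<otimes>\<^bsub>G\<^esub> y"
    using G unfolding projective_algebraic_group_def morphism2_on_def by blast
  from morphism_on_compose[OF morphism_on_segre_right[OF a] \<mu>(1)]
  show ?thesis by (rule morphism_on_cong) (simp add: \<mu>(2) a)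
qed

lemma zariski_closed_set_mult:
  assumes G: "projective_algebraic_group G"
    and P: "zariski_closed P" "P \<subseteq> carrier G" and Q: "zariski_closed Q" "Q \<subseteq> carrier G"
  shows "zariski_closed (P <#>\<^bsub>G\<^esub> Q)"
proof -
  obtain \<mu> where \<mu>: "morphism_on (segre ` (carrier G \<times> carrier G)) (carrier G) \<mu>"
    "\<And>x y. x \<in> carrier G \<Longrightarrow> y \<in> carrier G \<Longrightarrow> \<mu> (segre (x, y)) = x \<otimes>\<^bsub>G\<^esub> y"
    using G unfolding projective_algebraic_group_def morphism2_on_def by blast
  have "segre ` (P \<times> Q) \<subseteq> segre ` (carrier G \<times> carrier G)" using P Q by (intro image_mono Sigma_mono)
  then have "morphism_on (segre ` (P \<times> Q)) (carrier G) \<mu>"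
    using morphism_on_apply[OF \<mu>(1)] by (intro morphism_on_restrict[OF \<mu>(1)]) blast+
  then have "zariski_closed (\<mu> ` segre ` (P \<times> Q))"
    by (rule zariski_closed_image[OF zariski_closed_segre[OF P(1) Q(1)]])
  also have "\<mu> ` segre ` (P \<times> Q) = (\<lambda>(x, y). x \<otimes>\<^bsub>G\<^esub> y) ` (P \<times> Q)"
    unfolding image_image using P(2) Q(2) by (intro image_cong) (auto simp: \<mu>(2) subset_iff)
  also have "\<dots> = P <#>\<^bsub>G\<^esub> Q" by (auto simp: set_mult_def)
  finally show ?thesis .
qed

lemma zariski_closed_INT:
  assumes "\<And>i. i \<in> I \<Longrightarrow> zariski_closed (S i)" shows "zariski_closed (\<Inter>i\<in>I. S i)"
proof (rule zariski_closedI)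
  fix p v assume "p \<notin> (\<Inter>i\<in>I. S i)" and v: "v \<in> homog_coords p"
  then obtain i where i: "i \<in> I" "p \<notin> S i" by blast
  from zariski_closed_separation[OF assms[OF i(1)] i(2) v] i(1)
  show "\<exists>d F. form d F \<and> F v \<noteq> 0 \<and> (\<forall>q\<in>\<Inter>i\<in>I. S i. \<forall>w\<in>homog_coords q. F w = 0)" by blast
qed

text \<open>
  If \<open>A\<close> and \<open>B\<close> are closed and cover \<open>P <#> Q\<close>, each irreducible translate \<open>a <# Q\<close> lies in one
  of them; both possibilities are closed conditions on \<open>a\<close>, so one of them holds on all of \<open>P\<close>.
\<close>

lemma zariski_irreducible_set_mult:
  assumes G: "projective_algebraic_group G"
    and P: "zariski_closed P" "zariski_irreducible P" "P \<subseteq> carrier G"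
    and Q: "zariski_closed Q" "zariski_irreducible Q" "Q \<subseteq> carrier G"
  shows "zariski_irreducible (P <#>\<^bsub>G\<^esub> Q)"
  unfolding zariski_irreducible_def
proof (intro conjI allI impI)
  have ne: "P \<noteq> {}" "Q \<noteq> {}" using P Q by (auto simp: zariski_irreducible_def)
  then show "P <#>\<^bsub>G\<^esub> Q \<noteq> {}" by (auto simp: set_mult_def)
  fix A B assume AB: "zariski_closed A \<and> zariski_closed B \<and> P <#>\<^bsub>G\<^esub> Q \<subseteq> A \<union> B"
  define W where "W D = {a \<in> P. \<forall>b\<in>Q. a \<otimes>\<^bsub>G\<^esub> b \<in> D}" for D
  have W: "zariski_closed (W D)" if D: "zariski_closed D" for D
  proof -
    have "zariski_closed {a \<in> P. a \<otimes>\<^bsub>G\<^esub> b \<in> D}" if b: "b \<in> Q" for b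
    proof -
      have r: "morphism_on (carrier G) (carrier G) (\<lambda>x. x \<otimes>\<^bsub>G\<^esub> b)"
        using morphism_on_right_translation[OF G] b Q(3) by blast
      then have "morphism_on P (carrier G) (\<lambda>x. x \<otimes>\<^bsub>G\<^esub> b)"
        using morphism_on_apply[OF r] P(3) by (intro morphism_on_restrict[OF r]) blast+
      then show ?thesis by (rule zariski_closed_preimage[OF P(1) _ D])
    qed
    then have "zariski_closed (\<Inter>b\<in>Q. {a \<in> P. a \<otimes>\<^bsub>G\<^esub> b \<in> D})" by (rule zariski_closed_INT)
    also have "(\<Inter>b\<in>Q. {a \<in> P. a \<otimes>\<^bsub>G\<^esub> b \<in> D}) = W D" using ne by (auto simp: W_def)
    finally show ?thesis .
  qed
  have "P \<subseteq> W A \<union> W B"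
  proof
    fix a assume a: "a \<in> P"
    have l: "morphism_on (carrier G) (carrier G) (\<lambda>x. a \<otimes>\<^bsub>G\<^esub> x)"
      using morphism_on_left_translation[OF G] a P(3) by blast
    then have "morphism_on Q (carrier G) (\<lambda>x. a \<otimes>\<^bsub>G\<^esub> x)"
      using morphism_on_apply[OF l] Q(3) by (intro morphism_on_restrict[OF l]) blast+
    then have "zariski_irreducible ((\<lambda>x. a \<otimes>\<^bsub>G\<^esub> x) ` Q)"
      by (rule zariski_irreducible_image[OF Q(1,2)])
    moreover have "(\<lambda>x. a \<otimes>\<^bsub>G\<^esub> x) ` Q \<subseteq> A \<union> B" using AB a by (auto simp: set_mult_def)
    ultimately have "(\<lambda>x. a \<otimes>\<^bsub>G\<^esub> x) ` Q \<subseteq> A \<or> (\<lambda>x. a \<otimes>\<^bsub>G\<^esub> x) ` Q \<subseteq> B"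
      using AB unfolding zariski_irreducible_def by blast
    then show "a \<in> W A \<union> W B" using a by (auto simp: W_def)
  qed
  then have "P \<subseteq> W A \<or> P \<subseteq> W B"
    using P(2) W AB unfolding zariski_irreducible_def by blast
  then show "P <#>\<^bsub>G\<^esub> Q \<subseteq> A \<or> P <#>\<^bsub>G\<^esub> Q \<subseteq> B" by (auto simp: W_def set_mult_def)
qed

section \<open>Equivalence along a curve\<close>

definition curve_link :: "('m::finite) cproj set \<Rightarrow> ('n::finite) cproj monoid \<Rightarrow>
    'n cproj \<Rightarrow> 'n cproj \<Rightarrow> bool" where
  "curve_link \<Gamma> G a b \<longleftrightarrow>
     (\<exists>f s t. morphism_on \<Gamma> (carrier G) f \<and> s \<in> \<Gamma> \<and> t \<in> \<Gamma> \<and> f s = a \<and> f t = b)"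

lemma curve_equiv_iff:
  "curve_equiv \<Gamma> G a b \<longleftrightarrow> (\<exists>(n :: nat) g. g 0 = a \<and> g n = b \<and> (\<forall>j\<le>n. g j \<in> carrier G) \<and>
     (\<forall>j\<in>{1..n}. curve_link \<Gamma> G (g (j - 1)) (g j)))"
  by (simp add: curve_equiv_def curve_link_def)

lemma curve_equiv_carrier: "curve_equiv \<Gamma> G a b \<Longrightarrow> a \<in> carrier G \<and> b \<in> carrier G"
  unfolding curve_equiv_def by (metis le0 order_refl)

lemma curve_equiv_refl: "a \<in> carrier G \<Longrightarrow> curve_equiv \<Gamma> G a a"
  unfolding curve_equiv_def by (intro exI[of _ 0] exI[of _ "\<lambda>_. a"]) simp

lemma curve_equiv_step:
  assumes "curve_equiv \<Gamma> G a (f s)" and f: "morphism_on \<Gamma> (carrier G) f" and st: "s \<in> \<Gamma>" "t \<in> \<Gamma>"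
  shows "curve_equiv \<Gamma> G a (f t)"
proof -
  obtain n and g :: "nat \<Rightarrow> _" where chain: "g 0 = a \<and> g n = f s \<and> (\<forall>j\<le>n. g j \<in> carrier G) \<and>
      (\<forall>j\<in>{1..n}. curve_link \<Gamma> G (g (j - 1)) (g j))"
    using assms(1) unfolding curve_equiv_iff by (elim exE) (rule that)
  then have g: "g 0 = a" "g n = f s" "\<forall>j\<le>n. g j \<in> carrier G"
    "\<forall>j\<in>{1..n}. curve_link \<Gamma> G (g (j - 1)) (g j)" by blast+
  define h where "h = g(Suc n := f t)"
  have h: "h j = g j" if "j \<le> n" for j using that by (simp add: h_def)
  have hn: "h (Suc n) = f t" by (simp add: h_def)
  have "h j \<in> carrier G" if "j \<le> Suc n" for j
    using that g(3) h hn morphism_on_apply[OF f st(2)] by (cases "j = Suc n") (auto simp: le_Suc_eq)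
  moreover have "curve_link \<Gamma> G (h (j - 1)) (h j)" if j: "j \<in> {1..Suc n}" for j
  proof (cases "j = Suc n")
    case True
    have "curve_link \<Gamma> G (f s) (f t)" using f st unfolding curve_link_def by blast
    then show ?thesis using True g(2) h[of n] hn by simp
  next
    case False
    then have jn: "j \<in> {1..n}" using j by simp
    then have "h j = g j" "h (j - 1) = g (j - 1)" by (auto intro: h)
    then show ?thesis using g(4) jn by (simp only:)
  qed
  moreover have "h 0 = a" using h[of 0] g(1) by simp
  ultimately show ?thesis
    unfolding curve_equiv_iff using hn by (intro exI[of _ "Suc n"] exI[of _ h]) blast
qed

lemma curve_equiv_induct [consumes 1, case_names refl step]:
  assumes "curve_equiv \<Gamma> G a b" "P a"
    and "\<And>f s t. curve_equiv \<Gamma> G a (f s) \<Longrightarrow> P (f s) \<Longrightarrow> morphism_on \<Gamma> (carrier G) f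
      \<Longrightarrow> s \<in> \<Gamma> \<Longrightarrow> t \<in> \<Gamma> \<Longrightarrow> P (f t)"
  shows "P b"
proof -
  obtain n and g :: "nat \<Rightarrow> _" where chain: "g 0 = a \<and> g n = b \<and> (\<forall>j\<le>n. g j \<in> carrier G) \<and>
      (\<forall>j\<in>{1..n}. curve_link \<Gamma> G (g (j - 1)) (g j))"
    using assms(1) unfolding curve_equiv_iff by (elim exE) (rule that)
  then have g: "g 0 = a" "g n = b" "\<forall>j\<le>n. g j \<in> carrier G"
    "\<forall>j\<in>{1..n}. curve_link \<Gamma> G (g (j - 1)) (g j)" by blast+
  have "curve_equiv \<Gamma> G a (g j) \<and> P (g j)" if "j \<le> n" for j
    using that
  proof (induction j)
    case 0
    have "g 0 \<in> carrier G" using g(3) by blast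
    then show ?case using g(1) assms(2) by (simp add: curve_equiv_refl)
  next
    case (Suc j)
    then obtain f s t where f: "morphism_on \<Gamma> (carrier G) f" "s \<in> \<Gamma>" "t \<in> \<Gamma>" "f s = g j" "f t = g (Suc j)"
      using g(4) unfolding curve_link_def by (metis Suc_le_eq atLeastAtMost_iff diff_Suc_1 le_add1 plus_1_eq_Suc)
    have IH: "curve_equiv \<Gamma> G a (f s)" "P (f s)" using Suc f(4) by auto
    show ?case
      using curve_equiv_step[OF IH(1) f(1-3)] assms(3)[OF IH f(1-3)] by (simp add: f(5))
  qed
  then show ?thesis using g(2) by blast
qed

lemma curve_equiv_trans:
  "curve_equiv \<Gamma> G b c \<Longrightarrow> curve_equiv \<Gamma> G a b \<Longrightarrow> curve_equiv \<Gamma> G a c"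
  by (induction rule: curve_equiv_induct) (auto intro: curve_equiv_step)

lemma curve_equiv_sym: "curve_equiv \<Gamma> G a b \<Longrightarrow> curve_equiv \<Gamma> G b a"
proof (frule curve_equiv_carrier, induction rule: curve_equiv_induct)
  case refl
  then show ?case by (simp add: curve_equiv_refl)
next
  case (step f s t)
  have "curve_equiv \<Gamma> G (f t) (f t)" using step by (simp add: curve_equiv_refl)
  then have "curve_equiv \<Gamma> G (f t) (f s)" using step by (metis curve_equiv_step)
  moreover have "curve_equiv \<Gamma> G (f s) a" using step by (simp add: curve_equiv_carrier)
  ultimately show ?case by (metis curve_equiv_trans)
qed

lemma curve_equiv_translate:
  assumes G: "projective_algebraic_group G" and c: "c \<in> carrier G"
    and "curve_equiv \<Gamma> G a b"
  shows "curve_equiv \<Gamma> G (c \<otimes>\<^bsub>G\<^esub> a) (c \<otimes>\<^bsub>G\<^esub> b)"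
  using assms(3)
proof (induction rule: curve_equiv_induct)
  case refl
  have "group G" using G by (simp add: projective_algebraic_group_def)
  then show ?case
    using curve_equiv_carrier[OF assms(3)] c by (intro curve_equiv_refl) (simp add: group.subgroup_self monoid.m_closed group.is_monoid)
next
  case (step f s t)
  from morphism_on_compose[OF step.hyps(2) morphism_on_left_translation[OF G c]]
  show ?case using curve_equiv_step[of \<Gamma> G _ "(\<lambda>x. c \<otimes>\<^bsub>G\<^esub> x) \<circ> f" s t] step by simp
qed

lemma curve_class_subgroup:
  fixes G :: "('n::finite) cproj monoid" (structure)
  assumes G: "projective_algebraic_group G"
  shows "subgroup (curve_class \<Gamma> G) G"
proof -
  interpret group G using G by (simp add: projective_algebraic_group_def)
  show ?thesis
  proof (rule subgroupI)
    show "curve_class \<Gamma> G \<subseteq> carrier G" using curve_equiv_carrier unfolding curve_class_def by blast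
    show "curve_class \<Gamma> G \<noteq> {}" using curve_equiv_refl[OF one_closed] by (auto simp: curve_class_def)
  next
    fix x assume x: "x \<in> curve_class \<Gamma> G"
    then have xc: "x \<in> carrier G" using curve_equiv_carrier unfolding curve_class_def by blast
    have "curve_equiv \<Gamma> G (inv x \<otimes> \<one>) (inv x \<otimes> x)"
      using x xc by (intro curve_equiv_translate[OF G]) (auto simp: curve_class_def)
    then have "curve_equiv \<Gamma> G (inv x) \<one>" using xc by simp
    then show "inv x \<in> curve_class \<Gamma> G" by (simp add: curve_class_def curve_equiv_sym)
  next
    fix x y assume x: "x \<in> curve_class \<Gamma> G" and y: "y \<in> curve_class \<Gamma> G"
    then have xc: "x \<in> carrier G" using curve_equiv_carrier unfolding curve_class_def by blast
    have "curve_equiv \<Gamma> G (x \<otimes> \<one>) (x \<otimes> y)"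
      using y xc by (intro curve_equiv_translate[OF G]) (auto simp: curve_class_def)
    then have "curve_equiv \<Gamma> G x (x \<otimes> y)" using xc by simp
    then show "x \<otimes> y \<in> curve_class \<Gamma> G" using x curve_equiv_trans unfolding curve_class_def by blast
  qed
qed

text \<open>
  Finite products of images of the curve that pass through the identity. The last condition makes
  the products grow with the number of factors.
\<close>

inductive_set curve_products ::
  "('m::finite) cproj set \<Rightarrow> ('n::finite) cproj monoid \<Rightarrow> 'n cproj set set" for \<Gamma> G where
  one: "{\<one>\<^bsub>G\<^esub>} \<in> curve_products \<Gamma> G"
| step: "P \<in> curve_products \<Gamma> G \<Longrightarrow> morphism_on \<Gamma> (carrier G) f \<Longrightarrow> \<one>\<^bsub>G\<^esub> \<in> f ` \<Gamma>
    \<Longrightarrow> P <#>\<^bsub>G\<^esub> f ` \<Gamma> \<in> curve_products \<Gamma> G"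

lemma morphism_on_const:
  assumes "q \<in> Y" shows "morphism_on X Y (\<lambda>_. q)"
proof (rule morphism_onI)
  obtain w where w: "w \<in> homog_coords q" using homog_coords_exists by blast
  fix p v
  show "\<exists>e C d F. form e C \<and> C v \<noteq> 0 \<and> (\<forall>j. form d (F j)) \<and>
      (\<forall>p\<in>X. \<forall>v\<in>homog_coords p. C v \<noteq> 0 \<longrightarrow> (\<chi> j. F j v) \<in> homog_coords q)"
    by (rule exI[of _ 0], rule exI[of _ "\<lambda>_. 1"], rule exI[of _ 0], rule exI[of _ "\<lambda>j _. w $ j"])
      (use w in \<open>simp add: form_const\<close>)
qed (use assms in auto)

lemma curve_products_properties:
  fixes G :: "('n::finite) cproj monoid" (structure)
  assumes G: "projective_algebraic_group G"
    and \<Gamma>: "zariski_closed \<Gamma>" "zariski_irreducible \<Gamma>" and "P \<in> curve_products \<Gamma> G"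
  shows "P \<subseteq> carrier G \<and> \<one>\<^bsub>G\<^esub> \<in> P \<and> zariski_closed P \<and> zariski_irreducible P"
  using assms(4)
proof induction
  case one
  interpret group G using G by (simp add: projective_algebraic_group_def)
  have c: "morphism_on \<Gamma> (carrier G) (\<lambda>_. \<one>\<^bsub>G\<^esub>)" by (rule morphism_on_const) simp
  have "(\<lambda>_. \<one>\<^bsub>G\<^esub>) ` \<Gamma> = {\<one>\<^bsub>G\<^esub>}" using \<Gamma>(2) by (auto simp: zariski_irreducible_def)
  then show ?case
    using zariski_closed_image[OF \<Gamma>(1) c] zariski_irreducible_image[OF \<Gamma> c] by simp
next
  case (step P f)
  interpret group G using G by (simp add: projective_algebraic_group_def)
  have f: "f ` \<Gamma> \<subseteq> carrier G" "zariski_closed (f ` \<Gamma>)" "zariski_irreducible (f ` \<Gamma>)"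
    using morphism_on_apply[OF step(2)] zariski_closed_image[OF \<Gamma>(1) step(2)]
      zariski_irreducible_image[OF \<Gamma> step(2)] by auto
  have P: "P \<subseteq> carrier G" "zariski_closed P" "zariski_irreducible P" "\<one> \<in> P" using step.IH by auto
  have "\<one> \<otimes> \<one> \<in> P <#> f ` \<Gamma>" using P(4) step(3) unfolding set_mult_def by blast
  then show ?case
    using zariski_closed_set_mult[OF G P(2,1) f(2,1)]
      zariski_irreducible_set_mult[OF G P(2,3,1) f(2,3,1)] set_mult_closed[OF P(1) f(1)] by simp
qed

lemma curve_products_mult:
  fixes G :: "('n::finite) cproj monoid" (structure)
  assumes G: "projective_algebraic_group G"
    and \<Gamma>: "zariski_closed \<Gamma>" "zariski_irreducible \<Gamma>"
    and P: "P \<in> curve_products \<Gamma> G" and Q: "Q \<in> curve_products \<Gamma> G"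
  shows "P <#>\<^bsub>G\<^esub> Q \<in> curve_products \<Gamma> G"
  using Q
proof induction
  case one
  interpret group G using G by (simp add: projective_algebraic_group_def)
  have "P <#> {\<one>} = P"
    using curve_products_properties[OF G \<Gamma> P] by (auto simp: set_mult_def subset_iff)
  then show ?case using P by simp
next
  case (step Q f)
  interpret group G using G by (simp add: projective_algebraic_group_def)
  have "f ` \<Gamma> \<subseteq> carrier G" using morphism_on_apply[OF step(2)] by auto
  then have "P <#> (Q <#> f ` \<Gamma>) = (P <#> Q) <#> f ` \<Gamma>"
    using curve_products_properties[OF G \<Gamma> P] curve_products_properties[OF G \<Gamma> step(1)]
    by (simp add: set_mult_assoc)
  then show ?case using curve_products.step[OF step.IH step(2,3)] by simp
qed

text \<open>
  A link from \<open>f s\<close> to \<open>f t\<close> is right multiplication by \<open>inv (f s) \<otimes> f t\<close>, a point of the image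
  of the translate of \<open>f\<close> that sends \<open>s\<close> to the identity. So chains from the identity trace out
  exactly the products.
\<close>

lemma curve_class_eq_Union_products:
  fixes G :: "('n::finite) cproj monoid" (structure)
  assumes G: "projective_algebraic_group G"
    and \<Gamma>: "zariski_closed \<Gamma>" "zariski_irreducible \<Gamma>"
  shows "curve_class \<Gamma> G = \<Union>(curve_products \<Gamma> G)"
proof
  interpret group G using G by (simp add: projective_algebraic_group_def)
  show "curve_class \<Gamma> G \<subseteq> \<Union>(curve_products \<Gamma> G)"
  proof
    fix x assume "x \<in> curve_class \<Gamma> G"
    then have "curve_equiv \<Gamma> G \<one> x" by (simp add: curve_class_def)
    then show "x \<in> \<Union>(curve_products \<Gamma> G)"
    proof (induction rule: curve_equiv_induct)
      case refl
      then show ?case using curve_products.one by blast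
    next
      case (step f s t)
      then obtain P where P: "P \<in> curve_products \<Gamma> G" "f s \<in> P" by blast
      have fc: "f s \<in> carrier G" "f t \<in> carrier G" using morphism_on_apply[OF step.hyps(2)] step.hyps(3,4) by auto
      define h where "h = (\<lambda>x. inv (f s) \<otimes> x) \<circ> f"
      have h: "morphism_on \<Gamma> (carrier G) h"
        unfolding h_def by (rule morphism_on_compose[OF step.hyps(2) morphism_on_left_translation[OF G]]) (simp add: fc)
      have "h s = \<one>" by (simp add: h_def fc)
      then have "P <#> h ` \<Gamma> \<in> curve_products \<Gamma> G"
        using step.hyps(3) by (intro curve_products.step[OF P(1) h]) force
      moreover have "f t = f s \<otimes> h t" by (simp add: h_def fc flip: m_assoc)
      then have "f t \<in> P <#> h ` \<Gamma>" using P(2) step.hyps(4) unfolding set_mult_def by blast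
      ultimately show ?case by blast
    qed
  qed
  have "P \<subseteq> curve_class \<Gamma> G" if "P \<in> curve_products \<Gamma> G" for P
    using that
  proof induction
    case one
    then show ?case using curve_equiv_refl[OF one_closed] by (simp add: curve_class_def)
  next
    case (step P f)
    show ?case
    proof
      fix x assume "x \<in> P <#> f ` \<Gamma>"
      then obtain p t where x: "x = p \<otimes> f t" "p \<in> P" "t \<in> \<Gamma>" unfolding set_mult_def by blast
      obtain s where s: "s \<in> \<Gamma>" "f s = \<one>" using step(3) by force
      have p: "curve_equiv \<Gamma> G \<one> p" using step.IH x(2) by (auto simp: curve_class_def)
      then have pc: "p \<in> carrier G" by (simp add: curve_equiv_carrier)
      have "morphism_on \<Gamma> (carrier G) ((\<lambda>x. p \<otimes> x) \<circ> f)"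
        by (rule morphism_on_compose[OF step(2) morphism_on_left_translation[OF G pc]])
      from curve_equiv_step[of \<Gamma> G "\<one>", OF _ this s(1) x(3)] p s(2) pc
      show "x \<in> curve_class \<Gamma> G" by (simp add: curve_class_def x(1))
    qed
  qed
  then show "\<Union>(curve_products \<Gamma> G) \<subseteq> curve_class \<Gamma> G" by blast
qed

text \<open>
  A maximal product \<open>P\<close> absorbs every other product \<open>Q\<close>, because both are contained in \<open>P <#> Q\<close>,
  which is again a product and hence equals \<open>P\<close>.
\<close>

theorem curve_class_closed_irreducible:
  fixes G :: "('n::finite) cproj monoid" (structure)
  assumes G: "projective_algebraic_group G"
    and \<Gamma>: "zariski_closed \<Gamma>" "zariski_irreducible \<Gamma>"
  shows "zariski_closed (curve_class \<Gamma> G) \<and> zariski_irreducible (curve_class \<Gamma> G)"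
proof -
  interpret group G using G by (simp add: projective_algebraic_group_def)
  note props = curve_products_properties[OF G \<Gamma>]
  have "\<exists>P\<in>curve_products \<Gamma> G. \<forall>Q\<in>curve_products \<Gamma> G. P \<subseteq> Q \<longrightarrow> Q = P"
  proof (rule maximal_irreducible_exists)
    show "curve_products \<Gamma> G \<noteq> {}" using curve_products.one by auto
  qed (simp add: props)
  then obtain P where P: "P \<in> curve_products \<Gamma> G"
    "\<And>Q. Q \<in> curve_products \<Gamma> G \<Longrightarrow> P \<subseteq> Q \<Longrightarrow> Q = P" by blast
  have "Q \<subseteq> P" if Q: "Q \<in> curve_products \<Gamma> G" for Q
  proof -
    have "P \<subseteq> P <#> Q" "Q \<subseteq> P <#> Q"
      using props[OF P(1)] props[OF Q] unfolding set_mult_def by (force simp: subset_iff)+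
    moreover have "P <#> Q = P" using calculation(1) P(2)[OF curve_products_mult[OF G \<Gamma> P(1) Q]] by blast
    ultimately show ?thesis by simp
  qed
  then have "curve_class \<Gamma> G = P" using P(1) curve_class_eq_Union_products[OF G \<Gamma>] by blast
  then show ?thesis using props[OF P(1)] by simp
qed

lemma abelian_subvariety_if_closed_irreducible_subgroup:
  fixes G :: "('n::finite) cproj monoid" (structure)
  assumes G: "projective_algebraic_group G" and H: "subgroup H G"
    and closed: "zariski_closed H" and irr: "zariski_irreducible H"
  shows "abelian_subvariety H G"
proof -
  interpret group G using G by (simp add: projective_algebraic_group_def)
  let ?H = "G\<lparr>carrier := H\<rparr>"
  have sub: "H \<subseteq> carrier G" using H by (simp add: subgroup.subset)
  obtain \<mu> where \<mu>: "morphism_on (segre ` (carrier G \<times> carrier G)) (carrier G) \<mu>"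
    "\<And>x y. x \<in> carrier G \<Longrightarrow> y \<in> carrier G \<Longrightarrow> \<mu> (segre (x, y)) = x \<otimes> y"
    using G unfolding projective_algebraic_group_def morphism2_on_def by blast
  have \<mu>H: "\<mu> (segre (x, y)) = x \<otimes> y" if "x \<in> H" "y \<in> H" for x y using that sub \<mu>(2) by blast
  have "morphism_on (segre ` (H \<times> H)) H \<mu>"
  proof (rule morphism_on_restrict[OF \<mu>(1)])
    show "segre ` (H \<times> H) \<subseteq> segre ` (carrier G \<times> carrier G)" using sub by (intro image_mono Sigma_mono)
    show "\<mu> ` segre ` (H \<times> H) \<subseteq> H" using \<mu>H subgroup.m_closed[OF H] by auto
  qed
  then have mult: "morphism2_on H H H (\<lambda>x y. x \<otimes> y)" unfolding morphism2_on_def using \<mu>H by blast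
  have "morphism_on (carrier G) (carrier G) (\<lambda>x. inv x)"
    using G by (simp add: projective_algebraic_group_def)
  from morphism_on_restrict[OF this sub, of H] have "morphism_on H H (\<lambda>x. inv x)"
    using subgroup.m_inv_closed[OF H] by blast
  then have inverse: "morphism_on H H (\<lambda>x. inv\<^bsub>?H\<^esub> x)"
    by (rule morphism_on_cong) (simp add: m_inv_consistent[OF H])
  have "group ?H" using H by (rule subgroup_imp_group)
  then show ?thesis
    using H closed irr mult inverse
    by (simp add: abelian_subvariety_def algebraic_subgroup_def abelian_variety_def
        projective_algebraic_group_def)
qed

theorem proposition4p1:
  fixes G :: "('n::finite) cproj monoid" and \<Gamma> :: "('m::finite) cproj set"
  assumes "projective_algebraic_group G"
    and "smooth_projective_curve \<Gamma>"
  shows "let \<theta> = curve_quotient_map \<Gamma> G;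
             K = {g \<in> carrier G. \<theta> g = \<theta> \<one>\<^bsub>G\<^esub>}
         in (\<exists>A\<^sub>0 X. abelian_subvariety A\<^sub>0 G \<and> finite X \<and> X \<subseteq> carrier G \<and>
               K = (\<Union>x\<in>X. x <#\<^bsub>G\<^esub> A\<^sub>0)) \<and>
            algebraic_subgroup K G"
proof -
  interpret group G using assms(1) by (simp add: projective_algebraic_group_def)
  let ?H = "curve_class \<Gamma> G"
  have H: "subgroup ?H G" by (rule curve_class_subgroup[OF assms(1)])
  have cl: "zariski_closed ?H" "zariski_irreducible ?H"
    using curve_class_closed_irreducible[OF assms(1)] assms(2)
    by (auto simp: smooth_projective_curve_def)
  have sub: "?H \<subseteq> carrier G" using H by (simp add: subgroup.subset)
  have one: "?H #>\<^bsub>G\<^esub> \<one>\<^bsub>G\<^esub> = ?H" using sub by (rule coset_mult_one)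
  have K: "{g \<in> carrier G. curve_quotient_map \<Gamma> G g = curve_quotient_map \<Gamma> G \<one>\<^bsub>G\<^esub>} = ?H"
    unfolding curve_quotient_map_def one
    using sub coset_join2[OF _ H] rcos_self[OF _ H] by blast
  have "?H = (\<Union>x\<in>{\<one>\<^bsub>G\<^esub>}. x <#\<^bsub>G\<^esub> ?H)" using lcos_mult_one[OF sub] by simp
  moreover have "abelian_subvariety ?H G"
    by (rule abelian_subvariety_if_closed_irreducible_subgroup[OF assms(1) H cl])
  ultimately have "\<exists>A\<^sub>0 X. abelian_subvariety A\<^sub>0 G \<and> finite X \<and> X \<subseteq> carrier G \<and>
      ?H = (\<Union>x\<in>X. x <#\<^bsub>G\<^esub> A\<^sub>0)"
    by (intro exI[of _ ?H] exI[of _ "{\<one>\<^bsub>G\<^esub>}"]) simp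
  then show ?thesis unfolding Let_def K using H cl by (simp add: algebraic_subgroup_def)
qed

end
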